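(* Let $G$ be a minimal non-$4$-choosable planar graph, embedded in the plane, and let $W$ be a subgraph of $G$ isomorphic to the wheel $W_5$. If every vertex of $W$ has degree at most $5$ in $G$, then at least three vertices of $W$ have degree exactly $5$ in $G$.
   Context: All graphs are finite, simple and undirected. A graph is $4$-choosable if for every assignment of lists of size $4$ to its vertices there is a proper coloring choosing each vertex's color from its list. A minimal non-$4$-choosable planar graph is a planar graph that is not $4$-choosable and has the minimum number of vertices among such graphs. The wheel $W_5$ is the $5$-vertex graph obtained by joining one vertex (the hub) to all four vertices of a $4$-cycle. *)

theory Defs
  imports "HOL-Analysis.Analysis" "Graph_Theory.Graph_Theory"
begin

text \<open>
  A finite simple undirected graph is a \<^locale>\<open>pair_graph\<close>: an edge joining \<open>u\<close> and \<open>v\<close> is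
  the pair of arcs \<open>(u, v)\<close>, \<open>(v, u)\<close>. Hence the degree of \<open>v\<close> is \<open>out_degree G v\<close>.
\<close>

definition list_coloring :: "'a pair_pre_digraph \<Rightarrow> ('a \<Rightarrow> 'c set) \<Rightarrow> ('a \<Rightarrow> 'c) \<Rightarrow> bool" where
  "list_coloring G L f \<longleftrightarrow>
     (\<forall>v\<in>pverts G. f v \<in> L v) \<and> (\<forall>(u, v)\<in>parcs G. f u \<noteq> f v)"

text \<open>Only finitely many colors occur in the lists of a finite graph, so natural numbers suffice
  as colors.\<close>

definition choosable :: "nat \<Rightarrow> 'a pair_pre_digraph \<Rightarrow> bool" where
  "choosable k G \<longleftrightarrow>
     (\<forall>L :: 'a \<Rightarrow> nat set. (\<forall>v\<in>pverts G. finite (L v) \<and> card (L v) = k) \<longrightarrow>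
        (\<exists>f. list_coloring G L f))"

text \<open>
  \<open>p\<close> places the vertices and \<open>c\<close> draws the edges as simple arcs; the two orientations of an edge
  are drawn as the same point set. By the last two conditions the curves of distinct edges meet
  only in common end vertices.
\<close>

definition plane_embedding ::
    "'a pair_pre_digraph \<Rightarrow> ('a \<Rightarrow> complex) \<Rightarrow> ('a \<times> 'a \<Rightarrow> real \<Rightarrow> complex) \<Rightarrow> bool" where
  "plane_embedding G p c \<longleftrightarrow>
     inj_on p (pverts G) \<and>
     (\<forall>(u, v)\<in>parcs G.
        arc (c (u, v)) \<and> pathstart (c (u, v)) = p u \<and> pathfinish (c (u, v)) = p v \<and>
        path_image (c (v, u)) = path_image (c (u, v)) \<and>
        path_image (c (u, v)) \<inter> p ` pverts G = {p u, p v}) \<and>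
     (\<forall>(u, v)\<in>parcs G. \<forall>(x, y)\<in>parcs G. {u, v} \<noteq> {x, y} \<longrightarrow>
        path_image (c (u, v)) \<inter> path_image (c (x, y)) \<subseteq> p ` pverts G)"

definition planar :: "'a pair_pre_digraph \<Rightarrow> bool" where
  "planar G \<longleftrightarrow> (\<exists>p c. plane_embedding G p c)"

text \<open>Every finite graph has an isomorphic copy on natural numbers, so comparing with those graphs
  compares with all finite graphs.\<close>

definition minimal_non_4_choosable_planar :: "'a pair_pre_digraph \<Rightarrow> bool" where
  "minimal_non_4_choosable_planar G \<longleftrightarrow>
     pair_graph G \<and> planar G \<and> \<not> choosable 4 G \<and>
     (\<forall>H :: nat pair_pre_digraph. pair_graph H \<and> planar H \<and> \<not> choosable 4 H \<longrightarrow>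
        card (pverts G) \<le> card (pverts H))"

text \<open>The hub is \<open>0\<close>; the rim is the cycle \<open>1, 2, 3, 4\<close>.\<close>

definition wheel5 :: "nat pair_pre_digraph" where
  "wheel5 =
     (let E = {(0, 1), (0, 2), (0, 3), (0, 4), (1, 2), (2, 3), (3, 4), (4, 1)}
      in \<lparr> pverts = {0, 1, 2, 3, 4}, parcs = E \<union> E\<inverse> \<rparr>)"

end

theory Submission
  imports Defs
begin

text \<open>
  Suppose at most two vertices of \<open>W\<close> have degree 5. Color \<open>G - W\<close> by minimality; the residual lists
  of the graph induced on \<open>W\<close> are then large enough to finish, except in two situations. If both
  chords of the rim are present, \<open>W\<close> is a \<open>K\<^sub>5\<close>, which is not planar. If exactly one chord is present
  and the two nonadjacent rim vertices \<open>x, y\<close> are the ones of degree 5, the other three vertices form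
  a triangle without further neighbors, and by planarity it separates \<open>x\<close> from \<open>y\<close>. If \<open>A\<close> and \<open>B\<close>
  denote the two sides, the sets of colors of \<open>x\<close> extending to \<open>A\<close> and of \<open>y\<close> extending to \<open>B\<close> must
  be disjoint subsets of the list of a triangle vertex, and each has at least two elements. But for
  the smaller side, say \<open>A\<close>, at least three colors extend: otherwise two copies of \<open>A\<close> sharing \<open>x\<close>,
  the second one with permuted colors, would form a smaller non-4-choosable planar graph.
\<close>

text \<open>A vertex with \<open>k\<close> neighbors inside \<open>W\<close> keeps at least
  \<open>k - (deg - 4)\<close> colors after \<open>G - W\<close> is colored. So the residual lists
  are as large as the degrees in the graph induced on \<open>W\<close>, and each vertex of degree 5
  costs one color. Two missing colors are harmless except for K5 minus an edge: the lists {1,2} and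
  {3,4} on the nonadjacent vertices and {1,2,3,4} on the triangle admit no coloring. There the
  coloring outside \<open>W\<close> has to be changed, so each side of the triangle is studied as a
  graph of its own. The constants fit tightly. Two copies of \<open>A\<close> sharing
  \<open>x\<close> have 2|A| - 1 vertices, hence the smaller side. A set of at most two among four
  colors can be permuted off itself, hence three colors extend, and 3 + 2 > 4. Edges are arbitrary
  arcs, so planarity enters through point-set topology. That a triangle separates is the
  nonplanarity of K5 with one edge replaced by a path. Two copies are drawn with a common vertex by
  a square root, which avoids choosing an outer face.\<close>

hide_const (open) Digraph_Component.connected

section \<open>Topology of the plane\<close>

text \<open>Two crossing chords \<open>M\<close> and \<open>N\<close> on the same side \<open>S\<close> of the closed curve \<open>J \<union> J'\<close>: a point of \<open>N\<close>
  and a point of the other side \<open>S'\<close> are joined around \<open>J \<union> M\<close> through \<open>y\<close> and around \<open>J' \<union> M\<close> through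
  \<open>x\<close>, so Janiszewski's theorem joins them in the complement of \<open>J \<union> J'\<close>.\<close>

lemma crossing_chords:
  fixes S S' :: "complex set"
  assumes S: "open S" "open S'" "S \<inter> S' = {}" "S \<union> S' = - (J \<union> J')"
    and S': "connected S'" "S' \<noteq> {}" "J \<union> J' \<subseteq> closure S'"
    and cJ: "compact J" "compact J'"
    and M: "compact M" "connected M" "M \<inter> S' = {}" "J \<inter> J' \<subseteq> M"
    and N: "connected N" "N \<noteq> {}" "N \<subseteq> S" "N \<inter> M = {}" "x \<in> closure N" "y \<in> closure N"
    and x: "x \<in> J" "x \<notin> J'" "x \<notin> M"
    and y: "y \<in> J'" "y \<notin> J" "y \<notin> M"
  shows False
proof -
  obtain w z where w: "w \<in> S'" and z: "z \<in> N" using S' N by blast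
  have link: "connected (insert v S' \<union> insert v N)" if "v \<in> closure S'" "v \<in> closure N" for v
  proof (rule connected_Un)
    show "connected (insert v S')" "connected (insert v N)"
      using that closure_subset[of S'] closure_subset[of N]
      by (auto intro: connected_intermediate_closure[OF S'(1)] connected_intermediate_closure[OF N(1)])
  qed auto
  have "connected_component (- (J \<union> M)) w z"
    unfolding connected_component_def
    using link[of y] y S S' N M w z
    by (intro exI[of _ "insert y S' \<union> insert y N"]) auto
  moreover have "connected_component (- (J' \<union> M)) w z"
    unfolding connected_component_def
    using link[of x] x S S' N M w z
    by (intro exI[of _ "insert x S' \<union> insert x N"]) auto
  \<comment> \<open>Janiszewski's theorem asks for a connected intersection; since \<open>M\<close>
    contains \<open>J \<inter> J'\<close>, the intersection is \<open>M\<close> itself.\<close>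
  moreover have "(J \<union> M) \<inter> (J' \<union> M) = M" using M by auto
  ultimately have "connected_component (- ((J \<union> M) \<union> (J' \<union> M))) w z"
    using Janiszewski[of "J \<union> M" "J' \<union> M" w z] cJ M
    by (simp add: compact_Un compact_imp_closed closed_Un)
  then obtain C where C: "connected C" "C \<subseteq> - (J \<union> J')" "w \<in> C" "z \<in> C"
    unfolding connected_component_def by blast
  show False
    using connectedD[OF C(1) S(1,2)] C S N w z by blast
qed

text \<open>The image of the open interval is connected and dense in the arc, and removing some end
  points leaves a set between that image and its closure.\<close>

lemma arc_open_connected:
  assumes "arc g" "X \<subseteq> {pathstart g, pathfinish g}"
  shows "connected (path_image g - X)"
    and "path_image g \<subseteq> closure (path_image g - X)"
proof -
  let ?O = "path_image g - {pathstart g, pathfinish g}"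
  have O: "?O = g ` {0<..<1}"
    by (simp add: assms arc_imp_simple_path simple_path_endless)
  have "continuous_on (closure {0<..<1}) g"
    using assms by (simp add: arc_def path_def)
  then have "g ` closure {0<..<1} \<subseteq> closure (g ` {0<..<1})"
    by (rule image_closure_subset) (auto simp: closure_subset)
  then have cl: "path_image g \<subseteq> closure ?O"
    unfolding O by (simp add: path_image_def)
  have "connected ?O"
    by (simp add: assms arc_imp_simple_path connected_simple_path_endless)
  then show "connected (path_image g - X)"
    by (rule connected_intermediate_closure) (use cl assms in auto)
  show "path_image g \<subseteq> closure (path_image g - X)"
    using cl closure_mono[of ?O "path_image g - X"] assms by blast
qed

text \<open>The closed curve is the 4-cycle \<open>a x b y\<close>. The chords \<open>ab\<close> and \<open>xy\<close> lie on different sides, yet each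
  of them is crossed by a chord through \<open>c\<close> and hence lies on the side not containing \<open>c\<close>.\<close>

lemma no_topological_K5:
  fixes E :: "'v set \<Rightarrow> complex set" and P :: "'v \<Rightarrow> complex"
  assumes dist: "distinct [a, b, c, x, y]"
    and inj: "inj_on P {a, b, c, x, y}"
    and arcs: "\<And>u v. u \<in> {a, b, c, x, y} \<Longrightarrow> v \<in> {a, b, c, x, y} \<Longrightarrow> u \<noteq> v \<Longrightarrow>
      \<exists>g. arc g \<and> path_image g = E {u, v} \<and> pathstart g = P u \<and> pathfinish g = P v"
    and meet: "\<And>u v u' v'. {u, v, u', v'} \<subseteq> {a, b, c, x, y} \<Longrightarrow> u \<noteq> v \<Longrightarrow> u' \<noteq> v' \<Longrightarrow>
      {u, v} \<noteq> {u', v'} \<Longrightarrow> E {u, v} \<inter> E {u', v'} \<subseteq> P ` ({u, v} \<inter> {u', v'})"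
  shows False
proof -
  let ?V = "{a, b, c, x, y}"
  have ends: "P u \<in> E {u, v}" "P v \<in> E {u, v}" if "u \<in> ?V" "v \<in> ?V" "u \<noteq> v" for u v
    using arcs[OF that] pathstart_in_path_image pathfinish_in_path_image by metis+
  have comp: "compact (E {u, v})" and conE: "connected (E {u, v})" if "u \<in> ?V" "v \<in> ?V" "u \<noteq> v" for u v
    using arcs[OF that] compact_arc_image connected_arc_image by metis+
  have con: "connected (E {u, v} - X)" and clo: "E {u, v} \<subseteq> closure (E {u, v} - X)"
    if "u \<in> ?V" "v \<in> ?V" "u \<noteq> v" "X \<subseteq> {P u, P v}" for u v X
    using arcs[OF that(1-3)] that(4) arc_open_connected by metis+
  \<comment> \<open>The hypotheses restrict only intersections of edges. A vertex is kept off the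
    edge \<open>uv\<close> by an edge \<open>wz\<close> that shares no end with \<open>uv\<close>,
    and five vertices leave room for such a \<open>z\<close>.\<close>
  have notin: "P w \<notin> E {u, v}" if "{u, v, w} \<subseteq> ?V" "u \<noteq> v" "w \<noteq> u" "w \<noteq> v" for u v w
  proof
    assume "P w \<in> E {u, v}"
    moreover have "\<exists>z \<in> ?V. z \<noteq> u \<and> z \<noteq> v \<and> z \<noteq> w"
      using dist by (auto simp: doubleton_eq_iff)
    then obtain z where z: "z \<in> ?V" "z \<noteq> u" "z \<noteq> v" "z \<noteq> w" by blast
    have "P w \<in> E {w, z}" using ends[of w z] that z by auto
    moreover have "E {u, v} \<inter> E {w, z} \<subseteq> P ` ({u, v} \<inter> {w, z})"
      using that z by (intro meet) auto
    ultimately show False using that z by auto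
  qed
  have neP: "P u \<noteq> P v" if "u \<in> ?V" "v \<in> ?V" "u \<noteq> v" for u v
    using inj that by (meson inj_onD)
  define J1 where "J1 = E {a, x} \<union> E {x, b}"
  define J2 where "J2 = E {b, y} \<union> E {y, a}"
  have J12: "J1 \<inter> J2 \<subseteq> {P a, P b}"
    unfolding J1_def J2_def
    using meet[of a x b y] meet[of a x y a] meet[of x b b y] meet[of x b y a] dist by (auto simp: doubleton_eq_iff)
  obtain g1 where g1: "arc g1" "path_image g1 = E {a, x}" "pathstart g1 = P a" "pathfinish g1 = P x"
    using arcs[of a x] dist by (auto simp: doubleton_eq_iff)
  obtain g2 where g2: "arc g2" "path_image g2 = E {x, b}" "pathstart g2 = P x" "pathfinish g2 = P b"
    using arcs[of x b] dist by (auto simp: doubleton_eq_iff)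
  obtain g3 where g3: "arc g3" "path_image g3 = E {b, y}" "pathstart g3 = P b" "pathfinish g3 = P y"
    using arcs[of b y] dist by (auto simp: doubleton_eq_iff)
  obtain g4 where g4: "arc g4" "path_image g4 = E {y, a}" "pathstart g4 = P y" "pathfinish g4 = P a"
    using arcs[of y a] dist by (auto simp: doubleton_eq_iff)
  have h1: "arc (g1 +++ g2)" using g1 g2 meet[of a x x b] dist by (intro arc_join) (auto simp: doubleton_eq_iff)
  have h2: "arc (g3 +++ g4)" using g3 g4 meet[of b y y a] dist by (intro arc_join) (auto simp: doubleton_eq_iff)
  define \<gamma> where "\<gamma> = (g1 +++ g2) +++ (g3 +++ g4)"
  have pim: "path_image (g1 +++ g2) = J1" "path_image (g3 +++ g4) = J2"
    using g1 g2 g3 g4 by (simp_all add: path_image_join J1_def J2_def)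
  have \<gamma>: "simple_path \<gamma>" "pathfinish \<gamma> = pathstart \<gamma>" "path_image \<gamma> = J1 \<union> J2"
    unfolding \<gamma>_def using h1 h2 J12 pim g1 g2 g3 g4
    by (auto intro!: simple_path_join_loop simp: path_image_join)
  have cJ: "compact J1" "compact J2" 
    unfolding J1_def J2_def using comp dist by (auto intro!: compact_Un)
  let ?I = "inside (J1 \<union> J2)" and ?O = "outside (J1 \<union> J2)"
  have jordan: "?I \<noteq> {}" "open ?I" "connected ?I" "?O \<noteq> {}" "open ?O" "connected ?O"
     "?I \<inter> ?O = {}" "?I \<union> ?O = - (J1 \<union> J2)"
     "J1 \<union> J2 \<subseteq> closure ?I" "J1 \<union> J2 \<subseteq> closure ?O"
    using Jordan_inside_outside[OF \<gamma>(1,2)] \<gamma>(3) by (auto simp: frontier_def)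
  \<comment> \<open>Inside and outside enter symmetrically, so that \<open>P c\<close> may lie in
    either of them and the two roles can be exchanged.\<close>
  define side where "side S S' \<longleftrightarrow> open S \<and> open S' \<and> S \<inter> S' = {} \<and> S \<union> S' = - (J1 \<union> J2) \<and>
    connected S' \<and> S' \<noteq> {} \<and> J1 \<union> J2 \<subseteq> closure S'" for S S' :: "complex set"
  have cross: False if "side S S'" "compact M" "connected M" "M \<inter> S' = {}" "{P a, P b} \<subseteq> M"
    "connected N" "N \<noteq> {}" "N \<subseteq> S" "N \<inter> M = {}" "P x \<in> closure N" "P y \<in> closure N"
    "P x \<notin> M" "P y \<notin> M" for S S' M N
  proof (rule crossing_chords[where J = J1 and J' = J2 and M = M and N = N and S = S and S' = S'
        and x = "P x" and y = "P y"])
    show "P x \<in> J1" "P y \<in> J2" "P x \<notin> J2" "P y \<notin> J1"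
      unfolding J1_def J2_def
      using ends[of a x] ends[of y a] notin[of b y x] notin[of y a x] notin[of a x y]
        notin[of x b y] dist by (auto simp: doubleton_eq_iff)
    show "J1 \<inter> J2 \<subseteq> M" using J12 that by blast
  qed (use that cJ in \<open>auto simp: side_def\<close>)
  have dich: "N \<subseteq> S \<or> N \<subseteq> S'" if "side S S'" "connected N" "N \<inter> (J1 \<union> J2) = {}" for S S' N
    using connectedD[OF that(2), of S S'] that unfolding side_def by blast
  \<comment> \<open>The paths \<open>a c b\<close> and \<open>x c y\<close> are the chords through
    \<open>c\<close>: \<open>A\<close> serves as the compact chord \<open>M\<close>, and
    \<open>X\<close>, without its ends, as \<open>N\<close>. \<open>A'\<close> is \<open>A\<close>
    without its ends; it avoids the closed curve, so \<open>dich\<close> puts it on one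
    side.\<close>
  define A where "A = E {c, a} \<union> E {c, b}"
  define X where "X = (E {c, x} - {P x}) \<union> (E {c, y} - {P y})"
  define A' where "A' = (E {c, a} - {P a}) \<union> (E {c, b} - {P b})"
  have c0: "P c \<in> X" "P c \<in> A'"
    unfolding X_def A'_def using ends[of c x] ends[of c a] neP[of c x] neP[of c a] dist by (auto simp: doubleton_eq_iff)
  have conX: "connected X" and conA: "connected A" and conA': "connected A'"
    unfolding X_def A_def A'_def
    by (rule connected_Un; use con[of c x "{P x}"] con[of c y "{P y}"] conE[of c a] conE[of c b]
        con[of c a "{P a}"] con[of c b "{P b}"] ends[of c x] ends[of c y] ends[of c a] ends[of c b]
        neP[of c] dist in \<open>auto; blast\<close>)+
  have "E {c, x} \<inter> (J1 \<union> J2) \<subseteq> {P x}" "E {c, y} \<inter> (J1 \<union> J2) \<subseteq> {P y}"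
       "E {c, a} \<inter> (J1 \<union> J2) \<subseteq> {P a}" "E {c, b} \<inter> (J1 \<union> J2) \<subseteq> {P b}"
    unfolding J1_def J2_def Int_Un_distrib
    using dist
      meet[of c x a x] meet[of c x x b] meet[of c x b y] meet[of c x y a]
      meet[of c y a x] meet[of c y x b] meet[of c y b y] meet[of c y y a]
      meet[of c a a x] meet[of c a x b] meet[of c a b y] meet[of c a y a]
      meet[of c b a x] meet[of c b x b] meet[of c b b y] meet[of c b y a]
    by (auto simp: doubleton_eq_iff)
  then have XJ: "X \<inter> (J1 \<union> J2) = {}" and AJ: "A' \<inter> (J1 \<union> J2) = {}"
    unfolding X_def A'_def by blast+
  have abJ: "(E {a, b} - {P a, P b}) \<inter> (J1 \<union> J2) = {}"
    unfolding J1_def J2_def using dist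
      meet[of a b a x] meet[of a b x b] meet[of a b b y] meet[of a b y a] by (auto simp: doubleton_eq_iff)
  have xyJ: "(E {x, y} - {P x, P y}) \<inter> (J1 \<union> J2) = {}"
    unfolding J1_def J2_def using dist
      meet[of x y a x] meet[of x y x b] meet[of x y b y] meet[of x y y a] by (auto simp: doubleton_eq_iff)
  have core: False if s: "side S S'" "side S' S" and cS: "P c \<in> S" for S S'
  proof -
    have SS: "S \<inter> S' = {}" "S \<union> S' = - (J1 \<union> J2)" using s by (auto simp: side_def)
    have abin: "P a \<in> J1 \<union> J2" "P b \<in> J1 \<union> J2"
      unfolding J1_def J2_def using ends[of a x] ends[of x b] dist by (auto simp: doubleton_eq_iff)
    have XS: "X \<subseteq> S" using dich[OF s(1) conX XJ] c0 cS SS by blast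
    have "A' \<subseteq> S" using dich[OF s(1) conA' AJ] c0 cS SS by blast
    then have AS: "A \<inter> S' = {}" unfolding A_def A'_def using SS abin by blast
    have clX: "P x \<in> closure X" "P y \<in> closure X"
      unfolding X_def closure_Un
      using clo[of c x "{P x}"] clo[of c y "{P y}"] ends[of c x] ends[of c y] dist by (auto simp: doubleton_eq_iff)
    let ?M = "E {a, b}" and ?N = "E {x, y} - {P x, P y}"
    have M: "compact ?M" "connected ?M" "{P a, P b} \<subseteq> ?M" "P x \<notin> ?M" "P y \<notin> ?M"
      using comp[of a b] conE[of a b] ends[of a b] notin[of a b x] notin[of a b y] dist by (auto simp: doubleton_eq_iff)
    have clN: "P x \<in> closure ?N" "P y \<in> closure ?N"
      using clo[of x y "{P x, P y}"] ends[of x y] dist by (auto simp: doubleton_eq_iff)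
    then have N: "?N \<noteq> {}" by (metis closure_empty empty_iff)
    have Nc: "connected ?N"
      using con[of x y "{P x, P y}"] dist by auto
    have "E {a, b} - {P a, P b} \<subseteq> S \<or> E {a, b} - {P a, P b} \<subseteq> S'"
      using dich[OF s(1) _ abJ] con[of a b "{P a, P b}"] dist by (auto simp: doubleton_eq_iff)
    moreover have False if "E {a, b} - {P a, P b} \<subseteq> S"
    proof (rule cross[OF s(1), of ?M X])
      show "?M \<inter> S' = {}" using that SS abin by blast
      show "X \<inter> ?M = {}" unfolding X_def
        using meet[of c x a b] meet[of c y a b] dist by (auto simp: doubleton_eq_iff)
    qed (use M conX c0 XS clX in auto)
    ultimately have abS': "E {a, b} - {P a, P b} \<subseteq> S'" by blast
    have "?N \<subseteq> S \<or> ?N \<subseteq> S'"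
      using dich[OF s(1) Nc xyJ] .
    moreover have False if "?N \<subseteq> S"
    proof (rule cross[OF s(1), of A ?N])
      show "?N \<inter> A = {}" unfolding A_def
        using meet[of x y c a] meet[of x y c b] dist by (auto simp: doubleton_eq_iff)
      show "compact A" unfolding A_def using comp[of c a] comp[of c b] dist by (auto intro: compact_Un)
      show "{P a, P b} \<subseteq> A" "P x \<notin> A" "P y \<notin> A"
        unfolding A_def using ends[of c a] ends[of c b] notin[of c a x] notin[of c b x]
          notin[of c a y] notin[of c b y] dist by (auto simp: doubleton_eq_iff)
    qed (use conA AS N Nc clN that in auto)
    moreover have False if "?N \<subseteq> S'"
    proof (rule cross[OF s(2), of ?M ?N])
      show "?M \<inter> S = {}" using abS' SS abin by blast
      show "?N \<inter> ?M = {}" 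
        using meet[of x y a b] dist by (auto simp: doubleton_eq_iff)
    qed (use M N Nc clN that in auto)
    ultimately show False by blast
  qed
  have "side ?I ?O" "side ?O ?I" unfolding side_def using jordan by (simp_all add: Int_commute[of ?O] Un_commute[of ?O])
  moreover have "P c \<in> ?I \<or> P c \<in> ?O" using c0 XJ jordan(8) by blast
  ultimately show False using core by blast
qed

section \<open>A square root of a Moebius transformation along a cut\<close>

text \<open>The path \<open>g\<close> joins \<open>P\<close> to \<open>q\<close> off
  \<open>D - {P}\<close>, so the directions from \<open>P\<close> and from \<open>q\<close> are
  homotopic maps to the circle. Their quotient is then inessential and has a continuous argument
  \<theta>; the root is obtained by halving \<theta> and taking the root of the modulus.\<close>

lemma continuous_sqrt_moebius:
  fixes D :: "complex set"
  assumes g: "path g" "pathstart g = P" "pathfinish g = q" "path_image g \<inter> D \<subseteq> {P}" and q: "q \<notin> D"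
  obtains s where "continuous_on D s" "\<And>z. z \<in> D \<Longrightarrow> (s z)\<^sup>2 = (z - P) / (z - q)"
proof -
  let ?S = "D - {P}"
  let ?u = "\<lambda>a z :: complex. inverse (norm (z - a)) *\<^sub>R (z - a)"
  have "path_component (- ?S) P q"
    unfolding path_component_def using g q by (intro exI[of _ g]) auto
  then have "homotopic_with_canon (\<lambda>x. True) ?S (sphere 0 1) (?u P) (?u q)"
    by (rule Borsuk_maps_homotopic_in_path_component)
  then have "\<exists>c. homotopic_with_canon (\<lambda>x. True) ?S (sphere 0 1) (\<lambda>z. ?u P z / ?u q z) (\<lambda>x. c)"
    by (rule homotopic_circlemaps_divide[THEN iffD1, THEN conjunct2, THEN conjunct2, THEN conjunct2,
          THEN conjunct2])
  then obtain \<theta> where \<theta>: "continuous_on ?S \<theta>"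
    "\<And>z. z \<in> ?S \<Longrightarrow> ?u P z / ?u q z = exp (\<i> * of_real (\<theta> z))"
    unfolding inessential_eq_continuous_logarithm_circle by blast
  define r where "r z = sqrt (norm (z - P) / norm (z - q))" for z
  define s where "s z = (if z = P then 0 else of_real (r z) * exp (\<i> * of_real (\<theta> z / 2)))" for z
  have r: "continuous_on D r"
    unfolding r_def using q by (intro continuous_intros) auto
  have r0: "r P = 0" by (simp add: r_def)
  have norm_s: "norm (s z) = r z" for z
    by (simp add: s_def r_def norm_mult)
  have sq: "(s z)\<^sup>2 = (z - P) / (z - q)" if "z \<in> D" for z
  proof (cases "z = P")
    case False
    have "(s z)\<^sup>2 = of_real ((r z)\<^sup>2) * exp (\<i> * of_real (\<theta> z))"
      using False by (simp add: s_def power_mult_distrib flip: exp_double)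
    also have "\<dots> = of_real (norm (z - P) / norm (z - q)) * (?u P z / ?u q z)"
      using \<theta>(2)[of z] that False by (simp add: r_def)
    also have "\<dots> = (z - P) / (z - q)"
    proof -
      have "x / y * ((inverse x * v) / (inverse y * w)) = v / w" if "x \<noteq> 0" "y \<noteq> 0" for x y v w :: complex
        using that by (cases "w = 0") (auto simp: field_simps)
      from this[of "of_real (norm (z - P))" "of_real (norm (z - q))" "z - P" "z - q"]
      show ?thesis using that False q by (auto simp: scaleR_conv_of_real)
    qed
    finally show ?thesis .
  qed (simp add: s_def)
  have "continuous (at z within D) s" if z: "z \<in> D" for z
  proof (cases "z = P")
    case True
    \<comment> \<open>Nothing is known about \<theta> near \<open>P\<close>; continuity there comes
      from the modulus alone, which tends to 0.\<close>
    have "(r \<longlongrightarrow> r P) (at P within D)"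
      using r z True by (auto simp: continuous_on_def)
    then have "((\<lambda>z. norm (s z)) \<longlongrightarrow> 0) (at P within D)"
      using r0 by (simp add: norm_s)
    then show ?thesis
      using True by (simp add: continuous_within s_def[of P] tendsto_norm_zero_iff)
  next
    case False
    have "continuous_on ?S (\<lambda>z. of_real (r z) * exp (\<i> * of_real (\<theta> z / 2)))"
      by (intro continuous_intros \<theta>(1) continuous_on_subset[OF r]) auto
    then have "continuous_on ?S s"
      by (rule continuous_on_eq) (auto simp: s_def)
    then have "continuous (at z within ?S) s"
      using z False by (auto simp: continuous_on_eq_continuous_within)
    moreover have "at z within ?S = at z within D"
      using False by (intro at_within_nhd[of _ "- {P}"]) auto
    ultimately show ?thesis by (simp add: continuous_within)
  qed
  then have "continuous_on D s" by (simp add: continuous_on_eq_continuous_within)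
  with sq show thesis using that by blast
qed

section \<open>Plane graphs\<close>

lemma pair_graph_iff:
  "pair_graph G \<longleftrightarrow> finite (pverts G) \<and> parcs G \<subseteq> pverts G \<times> pverts G \<and> sym (parcs G) \<and> irrefl (parcs G)"
proof
  assume "pair_graph G"
  then interpret pair_graph G .
  show "finite (pverts G) \<and> parcs G \<subseteq> pverts G \<times> pverts G \<and> sym (parcs G) \<and> irrefl (parcs G)"
    using pair_finite_verts arc_fst_in_verts arc_snd_in_verts pair_sym_arcs pair_no_loops
    by (force simp: symmetric_def irrefl_def)
next
  assume *: "finite (pverts G) \<and> parcs G \<subseteq> pverts G \<times> pverts G \<and> sym (parcs G) \<and> irrefl (parcs G)"
  then have "finite (parcs G)" by (meson finite_SigmaI finite_subset)
  with * show "pair_graph G"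
    by unfold_locales (auto simp: symmetric_def irrefl_def)
qed

definition induced :: "'a pair_pre_digraph \<Rightarrow> 'a set \<Rightarrow> 'a pair_pre_digraph" where
  "induced G U = \<lparr>pverts = U, parcs = parcs G \<inter> U \<times> U\<rparr>"

lemma induced_simps [simp]:
  "pverts (induced G U) = U" "parcs (induced G U) = parcs G \<inter> U \<times> U"
  by (simp_all add: induced_def)

lemma pair_graph_induced: "pair_graph G \<Longrightarrow> U \<subseteq> pverts G \<Longrightarrow> pair_graph (induced G U)"
  by (auto simp: pair_graph_iff irrefl_def finite_subset intro!: symI dest: symD)

lemma plane_embedding_inj: "plane_embedding G p c \<Longrightarrow> inj_on p (pverts G)"
  by (simp add: plane_embedding_def)

lemma plane_embedding_edge:
  assumes "plane_embedding G p c" "(u, v) \<in> parcs G"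
  shows "arc (c (u, v))" "pathstart (c (u, v)) = p u" "pathfinish (c (u, v)) = p v"
    "path_image (c (v, u)) = path_image (c (u, v))"
    "path_image (c (u, v)) \<inter> p ` pverts G = {p u, p v}"
  using assms unfolding plane_embedding_def by fast+

lemma plane_embedding_ends:
  assumes "plane_embedding G p c" "(u, v) \<in> parcs G"
  shows "p u \<in> path_image (c (u, v))" "p v \<in> path_image (c (u, v))"
  using plane_embedding_edge(5)[OF assms] by blast+

lemma plane_embedding_edges:
  assumes "plane_embedding G p c" "(u, v) \<in> parcs G" "(x, y) \<in> parcs G" "{u, v} \<noteq> {x, y}"
  shows "path_image (c (u, v)) \<inter> path_image (c (x, y)) \<subseteq> p ` pverts G"
  using assms unfolding plane_embedding_def by fast

text \<open>The definition confines the intersection to vertex points; an edge contains no vertex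
  points but its ends, so injectivity of \<open>p\<close> sharpens this to common ends.\<close>

lemma plane_embedding_meet:
  assumes "plane_embedding G p c" "pair_graph G" "(u, v) \<in> parcs G" "(x, y) \<in> parcs G" "{u, v} \<noteq> {x, y}"
  shows "path_image (c (u, v)) \<inter> path_image (c (x, y)) \<subseteq> p ` ({u, v} \<inter> {x, y})"
proof -
  have "path_image (c (u, v)) \<inter> path_image (c (x, y)) \<subseteq> p ` {u, v} \<inter> p ` {x, y}"
    using plane_embedding_edges[OF assms(1,3,4,5)] plane_embedding_edge(5)[OF assms(1,3)]
      plane_embedding_edge(5)[OF assms(1,4)] by auto
  also have "\<dots> = p ` ({u, v} \<inter> {x, y})"
    by (rule inj_on_image_Int[OF plane_embedding_inj[OF assms(1)], symmetric])
      (use assms in \<open>auto simp: pair_graph_iff\<close>)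
  finally show ?thesis .
qed

text \<open>Serves both for induced subgraphs, with the identity as \<phi>, and for isomorphic
  copies on another vertex type.\<close>

lemma plane_embedding_pullback:
  assumes emb: "plane_embedding G p c" and inj: "inj_on \<phi> (pverts H)" and im: "\<phi> ` pverts H \<subseteq> pverts G"
    and arcs: "\<And>u v. (u, v) \<in> parcs H \<Longrightarrow> (\<phi> u, \<phi> v) \<in> parcs G"
    and wf: "parcs H \<subseteq> pverts H \<times> pverts H"
  shows "plane_embedding H (p \<circ> \<phi>) (\<lambda>(u, v). c (\<phi> u, \<phi> v))"
proof -
  have "inj_on (p \<circ> \<phi>) (pverts H)"
    using inj im plane_embedding_inj[OF emb] by (meson comp_inj_on inj_on_subset)
  moreover have "path_image (c (\<phi> u, \<phi> v)) \<inter> (p \<circ> \<phi>) ` pverts H = {p (\<phi> u), p (\<phi> v)}"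
    if "(u, v) \<in> parcs H" for u v
    using plane_embedding_edge(5)[OF emb arcs[OF that]] that im wf by fastforce
  moreover have "path_image (c (\<phi> u, \<phi> v)) \<inter> path_image (c (\<phi> x, \<phi> y)) \<subseteq> (p \<circ> \<phi>) ` pverts H"
    if e: "(u, v) \<in> parcs H" "(x, y) \<in> parcs H" "{u, v} \<noteq> {x, y}" for u v x y
  proof -
    have "\<phi> ` {u, v} \<noteq> \<phi> ` {x, y}"
      using inj_on_image_eq_iff[OF inj, of "{u, v}" "{x, y}"] e wf by auto
    then have "path_image (c (\<phi> u, \<phi> v)) \<inter> path_image (c (\<phi> x, \<phi> y)) \<subseteq> p ` pverts G"
      using plane_embedding_edges[OF emb arcs[OF e(1)] arcs[OF e(2)]] by simp
    then show ?thesis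
      using plane_embedding_edge(5)[OF emb arcs[OF e(1)]] e wf by fastforce
  qed
  ultimately show ?thesis
    unfolding plane_embedding_def using plane_embedding_edge(1-4)[OF emb arcs]
    by (simp add: split_beta)
qed

lemma planar_induced:
  assumes "plane_embedding G p c" "U \<subseteq> pverts G"
  shows "planar (induced G U)"
  unfolding planar_def
  using plane_embedding_pullback[OF assms(1), of id "induced G U"] assms(2) by auto

text \<open>Minimality compares only with graphs on natural numbers, whereas the smaller graphs
  arise on \<open>'a\<close> and on \<open>'a \<times> bool\<close>. A copy on natural numbers
  carries embedding and lists along the inverse renaming.\<close>

lemma choosable_smaller:
  fixes H :: "'b pair_pre_digraph"
  assumes min: "minimal_non_4_choosable_planar G" and H: "pair_graph H" "planar H"
    and card: "card (pverts H) < card (pverts G)"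
  shows "choosable 4 H"
proof -
  obtain \<phi> :: "'b \<Rightarrow> nat" where \<phi>: "inj_on \<phi> (pverts H)"
    using H finite_imp_inj_to_nat_seg by (metis pair_graph_iff)
  define K where "K = \<lparr>pverts = \<phi> ` pverts H, parcs = map_prod \<phi> \<phi> ` parcs H\<rparr>"
  have wf: "parcs H \<subseteq> pverts H \<times> pverts H" and fin: "finite (pverts H)"
    and irr: "irrefl (parcs H)" and sy: "sym (parcs H)"
    using H by (auto simp: pair_graph_iff)
  have K: "pair_graph K"
    unfolding pair_graph_iff K_def
    using wf fin irr sy inj_onD[OF \<phi>] by (fastforce simp: irrefl_def intro!: symI dest: symD)
  obtain p c where emb: "plane_embedding H p c" using H by (auto simp: planar_def)
  let ?\<psi> = "inv_into (pverts H) \<phi>"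
  have inv: "?\<psi> (\<phi> v) = v" if "v \<in> pverts H" for v using \<phi> that by simp
  have "planar K"
    unfolding planar_def
  proof (intro exI, rule plane_embedding_pullback[OF emb, of ?\<psi>])
    show "inj_on ?\<psi> (pverts K)" by (simp add: K_def inj_on_inv_into)
    show "?\<psi> ` pverts K \<subseteq> pverts H" using inv by (auto simp: K_def)
    show "(?\<psi> u, ?\<psi> v) \<in> parcs H" if "(u, v) \<in> parcs K" for u v
      using that inv wf by (auto simp: K_def)
    show "parcs K \<subseteq> pverts K \<times> pverts K" using wf by (auto simp: K_def)
  qed
  moreover have "card (pverts K) < card (pverts G)"
    using card by (simp add: K_def card_image[OF \<phi>])
  ultimately have ch: "choosable 4 K"
    using K min by (auto simp: minimal_non_4_choosable_planar_def not_le[symmetric])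
  show ?thesis
    unfolding choosable_def
  proof (intro allI impI)
    fix L :: "'b \<Rightarrow> nat set" assume L: "\<forall>v\<in>pverts H. finite (L v) \<and> card (L v) = 4"
    then have "\<forall>v\<in>pverts K. finite (L (?\<psi> v)) \<and> card (L (?\<psi> v)) = 4"
      by (auto simp: K_def inv)
    then obtain f where "list_coloring K (L \<circ> ?\<psi>) f"
      using ch unfolding choosable_def by (metis comp_apply)
    then have "list_coloring H L (f \<circ> \<phi>)"
      using inv by (fastforce simp: list_coloring_def K_def)
    then show "\<exists>f. list_coloring H L f" by blast
  qed
qed

section \<open>Drawings as point sets, and separation by triangles\<close>

definition drawing ::
    "'a pair_pre_digraph \<Rightarrow> ('a \<Rightarrow> complex) \<Rightarrow> ('a \<times> 'a \<Rightarrow> real \<Rightarrow> complex) \<Rightarrow> complex set" where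
  "drawing G p c = p ` pverts G \<union> (\<Union>e\<in>parcs G. path_image (c e))"

text \<open>An edge with the end \<open>v\<close> outside \<open>U\<close> differs from every edge
  within \<open>U\<close>, so only its other end can lie on their drawing.\<close>

lemma drawing_induced_meet:
  assumes emb: "plane_embedding G p c" and G: "pair_graph G" and e: "(u, v) \<in> parcs G"
    and U: "U \<subseteq> pverts G" "v \<notin> U"
  shows "path_image (c (u, v)) \<inter> drawing (induced G U) p c \<subseteq> p ` (U \<inter> {u})"
proof -
  have uv: "u \<in> pverts G" "v \<in> pverts G" using e G by (auto simp: pair_graph_iff)
  have "path_image (c (u, v)) \<inter> p ` U \<subseteq> p ` (U \<inter> {u})"
  proof -
    have "path_image (c (u, v)) \<inter> p ` U \<subseteq> p ` {u, v} \<inter> p ` U"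
      using plane_embedding_edge(5)[OF emb e] U by blast
    also have "\<dots> = p ` ({u, v} \<inter> U)"
      by (rule inj_on_image_Int[OF plane_embedding_inj[OF emb], symmetric]) (use U uv in auto)
    finally show ?thesis using U by auto
  qed
  moreover have "path_image (c (u, v)) \<inter> path_image (c (x, y)) \<subseteq> p ` (U \<inter> {u})"
    if "(x, y) \<in> parcs G" "x \<in> U" "y \<in> U" for x y
  proof -
    have "{u, v} \<noteq> {x, y}" using that U by auto
    from plane_embedding_meet[OF emb G e that(1) this] that U show ?thesis by auto
  qed
  ultimately show ?thesis unfolding drawing_def by (fastforce simp del: image_Int)
qed

lemma path_component_drawing:
  assumes emb: "plane_embedding G p c" and G: "pair_graph G"
    and xy: "(x, y) \<in> (parcs G \<inter> U \<times> U)\<^sup>*" and x: "x \<in> U"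
  shows "path_component (drawing (induced G U) p c) (p x) (p y)"
  using xy
proof induction
  case base
  show ?case using x by (auto simp: path_component_refl_eq drawing_def)
next
  case (step y z)
  then have e: "(y, z) \<in> parcs G" "(y, z) \<in> parcs (induced G U)" by auto
  have "path_component (drawing (induced G U) p c) (p y) (p z)"
    unfolding path_component_def
    using plane_embedding_edge[OF emb e(1)] e(2)
    by (intro exI[of _ "c (y, z)"]) (auto simp: drawing_def arc_imp_path)
  then show ?case using step path_component_trans by blast
qed

text \<open>A walk from \<open>x\<close> to \<open>y\<close> that avoids the triangle contains an
  arc which, as a tenth edge, completes a drawing of K5. If \<open>x\<close> and \<open>y\<close>
  are adjacent, the edge itself is such a walk, so the nonplanarity of K5 is included.\<close>

lemma separating_triangle:
  assumes emb: "plane_embedding G p c" and G: "pair_graph G"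
    and dist: "distinct [a, b, d, x, y]"
    and edges: "{(a, b), (a, d), (b, d), (x, a), (x, b), (x, d), (y, a), (y, b), (y, d)} \<subseteq> parcs G"
    and U: "U \<subseteq> pverts G - {a, b, d}" "x \<in> U" "y \<in> U"
  shows "(x, y) \<notin> (parcs G \<inter> U \<times> U)\<^sup>*"
proof
  assume "(x, y) \<in> (parcs G \<inter> U \<times> U)\<^sup>*"
  from path_component_drawing[OF emb G this \<open>x \<in> U\<close>]
  obtain g where g: "path g" "path_image g \<subseteq> drawing (induced G U) p c" "pathstart g = p x" "pathfinish g = p y"
    by (auto simp: path_component_def)
  have V: "{a, b, d, x, y} \<subseteq> pverts G" using edges G by (auto simp: pair_graph_iff)
  have sy: "(v, u) \<in> parcs G" if "(u, v) \<in> parcs G" for u v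
    using that G by (auto simp: pair_graph_iff dest: symD)
  have injp: "inj_on p {a, b, d, x, y}"
    by (rule inj_on_subset[OF plane_embedding_inj[OF emb] V])
  then have "p x \<noteq> p y" using dist by (auto dest: inj_onD)
  from path_contains_arc[OF g(1,3,4) this] obtain q where
    q: "arc q" "path_image q \<subseteq> path_image g" "pathstart q = p x" "pathfinish q = p y" by blast
  let ?V = "{a, b, d, x, y}"
  \<comment> \<open>Edges are indexed by unordered pairs; the two orientations have the same image,
    so the union is a single arc. The pair \<open>{x, y}\<close> always receives \<open>q\<close>,
    even if \<open>x\<close> and \<open>y\<close> are adjacent in \<open>G\<close>.\<close>
  define E where "E S = (if S = {x, y} then path_image q
    else \<Union>{path_image (c (u, v)) | u v. S = {u, v} \<and> (u, v) \<in> parcs G})" for S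
  have adj: "(u, v) \<in> parcs G" if "u \<in> ?V" "v \<in> ?V" "u \<noteq> v" "{u, v} \<noteq> {x, y}" for u v
    using that edges sy by auto
  have E_eq: "E {u, v} = path_image (c (u, v))" if "(u, v) \<in> parcs G" "{u, v} \<noteq> {x, y}" for u v
  proof -
    have "path_image (c (v, u)) = path_image (c (u, v))"
      using plane_embedding_edge(4)[OF emb that(1)] .
    then show ?thesis using that by (auto simp: E_def doubleton_eq_iff)
  qed
  have E_xy: "E {u, v} = path_image q" if "{u, v} = {x, y}" for u v using that by (simp add: E_def)
  \<comment> \<open>Each of the other nine edges has an end in the triangle, hence outside
    \<open>U\<close>, while \<open>q\<close> runs inside the drawing of \<open>U\<close>.\<close>
  have q_meet: "path_image q \<inter> E {u, v} \<subseteq> p ` ({x, y} \<inter> {u, v})"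
    if uv: "u \<in> ?V" "v \<in> ?V" "u \<noteq> v" "{u, v} \<noteq> {x, y}" for u v
  proof -
    have "u \<notin> U \<or> v \<notin> U" using uv U by auto
    then obtain w z where wz: "{u, v} = {w, z}" "z \<notin> U" by auto
    then have wz': "(w, z) \<in> parcs G" using adj[OF uv] sy by (auto simp: doubleton_eq_iff)
    have "E {u, v} = path_image (c (w, z))" using E_eq[OF wz'] wz uv by simp
    moreover have "path_image (c (w, z)) \<inter> drawing (induced G U) p c \<subseteq> p ` (U \<inter> {w})"
      using drawing_induced_meet[OF emb G wz'] U wz by blast
    moreover have "U \<inter> {w} \<subseteq> {x, y} \<inter> {u, v}" using uv wz U by (auto simp: doubleton_eq_iff)
    ultimately show ?thesis using q(2) g(2) by blast
  qed
  show False
  proof (rule no_topological_K5[OF dist injp, of E])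
    fix u v assume uv: "u \<in> ?V" "v \<in> ?V" "u \<noteq> v"
    show "\<exists>g. arc g \<and> path_image g = E {u, v} \<and> pathstart g = p u \<and> pathfinish g = p v"
    proof (cases "{u, v} = {x, y}")
      case True
      then consider "u = x" "v = y" | "u = y" "v = x" by (auto simp: doubleton_eq_iff)
      then show ?thesis
      proof cases
        case 1 then show ?thesis using q E_xy[OF True] by blast
      next
        case 2 then show ?thesis using q E_xy[OF True]
          by (intro exI[of _ "reversepath q"]) (auto simp: arc_reversepath)
      qed
    next
      case False
      then show ?thesis
        using plane_embedding_edge[OF emb adj[OF uv False]] E_eq[OF adj[OF uv False] False]
        by (intro exI[of _ "c (u, v)"]) auto
    qed
  next
    fix u v u' v'
    assume *: "{u, v, u', v'} \<subseteq> ?V" "u \<noteq> v" "u' \<noteq> v'" "{u, v} \<noteq> {u', v'}"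
    consider "{u, v} = {x, y}" | "{u', v'} = {x, y}" | "{u, v} \<noteq> {x, y}" "{u', v'} \<noteq> {x, y}" by blast
    then show "E {u, v} \<inter> E {u', v'} \<subseteq> p ` ({u, v} \<inter> {u', v'})"
    proof cases
      case 1
      then show ?thesis using q_meet[of u' v'] E_xy[OF 1] * by auto
    next
      case 2
      then show ?thesis using q_meet[of u v] E_xy[OF 2] * by (metis Int_commute insert_subset)
    next
      case 3
      then have "(u, v) \<in> parcs G" "(u', v') \<in> parcs G" using adj * by auto
      then show ?thesis using E_eq 3 plane_embedding_meet[OF emb G] * by metis
    qed
  qed
qed

section \<open>Two copies of a graph sharing a vertex\<close>

text \<open>The boolean names the copy. The shared vertex is \<open>(u, False)\<close>, and
  \<open>(u, True)\<close> is left out; this is why edges at \<open>u\<close> may join different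
  tags.\<close>

definition doubled :: "'a pair_pre_digraph \<Rightarrow> 'a \<Rightarrow> ('a \<times> bool) pair_pre_digraph" where
  "doubled G u =
    \<lparr>pverts = {(v, b). v \<in> pverts G \<and> (v = u \<longrightarrow> \<not> b)},
     parcs = {((v, b), (w, b')). (v, w) \<in> parcs G \<and> (v = u \<longrightarrow> \<not> b) \<and> (w = u \<longrightarrow> \<not> b') \<and>
       (b = b' \<or> v = u \<or> w = u)}\<rparr>"

lemma pair_graph_doubled:
  assumes "pair_graph G"
  shows "pair_graph (doubled G u)"
proof -
  have "finite (pverts G \<times> (UNIV :: bool set))" using assms by (simp add: pair_graph_iff)
  then have "finite (pverts (doubled G u))"
    by (rule finite_subset[rotated]) (auto simp: doubled_def)
  then show ?thesis
    using assms by (auto simp: pair_graph_iff doubled_def irrefl_def intro!: symI dest: symD)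
qed

lemma card_doubled:
  assumes "finite (pverts G)" "u \<in> pverts G"
  shows "card (pverts (doubled G u)) = 2 * card (pverts G) - 1"
proof -
  have eq: "pverts (doubled G u) = pverts G \<times> UNIV - {(u, True)}"
    by (auto simp: doubled_def)
  show ?thesis unfolding eq using assms by (simp add: card_cartesian_product mult.commute)
qed

text \<open>Draw the two copies as \<open>s\<close> and \<open>-s\<close> applied to the given drawing, where \<open>s\<close> is a branch of the square
  root of \<open>(z - p u) / (z - p h)\<close>. The branch exists because the edge \<open>u h\<close> joins the zero and the
  pole of this function outside the drawing; the copies meet only where \<open>s = 0\<close>, that is, at \<open>u\<close>.\<close>

lemma planar_doubled:
  assumes emb: "plane_embedding G p c" and G: "pair_graph G"
    and U: "U \<subseteq> pverts G" "u \<in> U" and h: "(u, h) \<in> parcs G" "h \<notin> U"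
  shows "planar (doubled (induced G U) u)"
proof -
  let ?H = "doubled (induced G U) u"
  define D where "D = drawing (induced G U) p c"
  have pD: "p v \<in> D" if "v \<in> U" for v using that by (auto simp: D_def drawing_def)
  have cD: "path_image (c (v, w)) \<subseteq> D" if "(v, w) \<in> parcs G" "v \<in> U" "w \<in> U" for v w
    using that by (auto simp: D_def drawing_def)
  have meetD: "path_image (c (u, h)) \<inter> D \<subseteq> {p u}"
    using drawing_induced_meet[OF emb G h(1) U(1) h(2)] by (auto simp: D_def)
  have inV: "u \<in> pverts G" "h \<in> pverts G" "u \<noteq> h" using h U G by (auto simp: pair_graph_iff)
  have injp: "v = w" if "p v = p w" "v \<in> pverts G" "w \<in> pverts G" for v w
    using plane_embedding_inj[OF emb] that by (meson inj_onD)
  have hD: "p h \<notin> D"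
    using meetD plane_embedding_ends(2)[OF emb h(1)] injp[of h u] inV by blast
  obtain s where s: "continuous_on D s" "\<And>z. z \<in> D \<Longrightarrow> (s z)\<^sup>2 = (z - p u) / (z - p h)"
    using continuous_sqrt_moebius[of "c (u, h)" "p u" "p h" D] meetD hD
      plane_embedding_edge[OF emb h(1)] arc_imp_path by blast
  have ne: "p u \<noteq> p h" using injp inV by blast
  define \<sigma> :: "bool \<Rightarrow> complex" where "\<sigma> b = (if b then -1 else 1)" for b
  have s0: "s (p u) = 0" using s(2)[OF pD[OF U(2)]] by simp
  \<comment> \<open>The squares are values of a Moebius map, which is injective because
    \<open>p u \<noteq> p h\<close>. Hence the points agree, and opposite signs are possible only
    where \<open>s\<close> vanishes.\<close>
  have s_eq: "z = z' \<and> (b = b' \<or> z = p u)" if eq: "\<sigma> b * s z = \<sigma> b' * s z'" and zD: "z \<in> D" "z' \<in> D" for z z' b b'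
  proof
    have "(\<sigma> b * s z)\<^sup>2 = (\<sigma> b' * s z')\<^sup>2" using eq by simp
    then have "(z - p u) / (z - p h) = (z' - p u) / (z' - p h)"
      using s(2) zD by (simp add: power_mult_distrib \<sigma>_def split: if_splits)
    moreover have "z \<noteq> p h" "z' \<noteq> p h" using zD hD by auto
    ultimately have "(z - p u) * (z' - p h) = (z' - p u) * (z - p h)" by (simp add: field_simps)
    then have "(z - z') * (p u - p h) = 0" by (simp add: algebra_simps)
    then show zz: "z = z'" using ne by simp
    show "b = b' \<or> z = p u"
    proof (rule ccontr)
      assume "\<not> (b = b' \<or> z = p u)"
      then have "s z = 0" "z \<noteq> p u" using eq zz by (auto simp: \<sigma>_def split: if_splits)
      then show False using s(2)[OF zD(1)] \<open>z \<noteq> p h\<close> by simp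
    qed
  qed
  define P where "P = (\<lambda>(v, b). \<sigma> b * s (p v))"
  \<comment> \<open>An edge belongs to the second copy as soon as one end is tagged
    \<open>True\<close>, since the other end may be \<open>u\<close> with its fixed tag
    \<open>False\<close>. The sign at \<open>u\<close> is immaterial because
    \<open>s (p u) = 0\<close>.\<close>
  define C where "C = (\<lambda>((v, b), (w, b')) t. \<sigma> (b \<or> b') * s (c (v, w) t))"
  have arcD: "(v, w) \<in> parcs G" "v \<in> U" "w \<in> U" "v = u \<longrightarrow> \<not> b" "w = u \<longrightarrow> \<not> b'" "b = b' \<or> v = u \<or> w = u"
    if "((v, b), (w, b')) \<in> parcs ?H" for v b w b'
    using that by (auto simp: doubled_def)
  have im: "path_image (C ((v, b), (w, b'))) = (\<lambda>z. \<sigma> (b \<or> b') * s z) ` path_image (c (v, w))" for v b w b'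
    by (auto simp: C_def path_image_def)
  have ends: "\<sigma> (b \<or> b') * s (p v) = P (v, b)" "\<sigma> (b \<or> b') * s (p w) = P (w, b')"
    if "((v, b), (w, b')) \<in> parcs ?H" for v b w b'
    using arcD[OF that] s0 by (auto simp: P_def)
  have "plane_embedding ?H P C"
    unfolding plane_embedding_def
  proof (intro conjI)
    show "inj_on P (pverts ?H)"
    proof (rule inj_onI, clarsimp simp: doubled_def P_def)
      fix v b w b'
      assume *: "\<sigma> b * s (p v) = \<sigma> b' * s (p w)" "v \<in> U" "w \<in> U" "v = u \<longrightarrow> \<not> b" "w = u \<longrightarrow> \<not> b'"
      from s_eq[OF *(1) pD pD] * have "p v = p w" "b = b' \<or> p v = p u" by auto
      then show "v = w \<and> b = b'" using injp[of v w] injp[of v u] * U by blast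
    qed
  next
    have "arc (C ((v, b), (w, b'))) \<and> pathstart (C ((v, b), (w, b'))) = P (v, b) \<and>
      pathfinish (C ((v, b), (w, b'))) = P (w, b') \<and>
      path_image (C ((w, b'), (v, b))) = path_image (C ((v, b), (w, b'))) \<and>
      path_image (C ((v, b), (w, b'))) \<inter> P ` pverts ?H = {P (v, b), P (w, b')}"
      if e: "((v, b), (w, b')) \<in> parcs ?H" for v b w b'
    proof (intro conjI)
      note e' = arcD[OF e] and emb' = plane_embedding_edge[OF emb arcD(1)[OF e]]
      show st: "pathstart (C ((v, b), (w, b'))) = P (v, b)" "pathfinish (C ((v, b), (w, b'))) = P (w, b')"
        using emb' ends[OF e] by (simp_all add: C_def pathstart_def pathfinish_def)
      show "path_image (C ((w, b'), (v, b))) = path_image (C ((v, b), (w, b')))"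
        using emb'(4) by (simp add: im disj_commute)
      have sub: "c (v, w) ` {0..1} \<subseteq> D" using cD[OF e'(1-3)] by (simp add: path_image_def)
      have "continuous_on {0..1} (\<lambda>t. s (c (v, w) t))"
        using emb'(1) by (intro continuous_on_compose2[OF s(1) _ sub]) (simp add: arc_def path_def)
      then have "path (C ((v, b), (w, b')))"
        by (simp add: path_def C_def continuous_on_mult_left)
      moreover have "inj_on (C ((v, b), (w, b'))) {0..1}"
      proof (rule inj_onI)
        fix t t' :: real assume t: "t \<in> {0..1}" "t' \<in> {0..1}"
          and eq: "C ((v, b), (w, b')) t = C ((v, b), (w, b')) t'"
        have "\<sigma> (b \<or> b') * s (c (v, w) t) = \<sigma> (b \<or> b') * s (c (v, w) t')"
          using eq unfolding C_def prod.case .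
        moreover have "c (v, w) t \<in> D" "c (v, w) t' \<in> D" using sub t by blast+
        ultimately have "c (v, w) t = c (v, w) t'" using s_eq by blast
        then show "t = t'" using emb'(1) t by (auto simp: arc_def dest: inj_onD)
      qed
      ultimately show "arc (C ((v, b), (w, b')))" by (simp add: arc_def)
      have "y \<in> {P (v, b), P (w, b')}" if y: "y \<in> path_image (C ((v, b), (w, b')))" "y \<in> P ` pverts ?H" for y
      proof -
        obtain z x b'' where z: "z \<in> path_image (c (v, w))" "y = \<sigma> (b \<or> b') * s z"
          and x: "x \<in> U" "y = \<sigma> b'' * s (p x)"
          using y by (auto simp: im P_def doubled_def)
        have "z = p x" using s_eq[of "b \<or> b'" z b'' "p x"] z x cD[OF e'(1-3)] pD by auto
        then have "z \<in> {p v, p w}" using z x emb'(5) U by blast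
        then show ?thesis using z ends[OF e] by auto
      qed
      moreover have "P (v, b) \<in> path_image (C ((v, b), (w, b')))" "P (w, b') \<in> path_image (C ((v, b), (w, b')))"
        using st by (metis pathstart_in_path_image, metis pathfinish_in_path_image)
      moreover have "(v, b) \<in> pverts ?H" "(w, b') \<in> pverts ?H" using e' by (auto simp: doubled_def)
      ultimately show "path_image (C ((v, b), (w, b'))) \<inter> P ` pverts ?H = {P (v, b), P (w, b')}" by auto
    qed
    then show "\<forall>(x, y)\<in>parcs ?H. arc (C (x, y)) \<and> pathstart (C (x, y)) = P x \<and>
      pathfinish (C (x, y)) = P y \<and> path_image (C (y, x)) = path_image (C (x, y)) \<and>
      path_image (C (x, y)) \<inter> P ` pverts ?H = {P x, P y}"
      by (simp add: Ball_def split_paired_all)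
  next
    have "path_image (C ((v, b), (w, b'))) \<inter> path_image (C ((x, d), (y, d'))) \<subseteq> P ` pverts ?H"
      if e: "((v, b), (w, b')) \<in> parcs ?H" "((x, d), (y, d')) \<in> parcs ?H"
        "{(v, b), (w, b')} \<noteq> {(x, d), (y, d')}" for v b w b' x d y d'
    proof
      fix r assume "r \<in> path_image (C ((v, b), (w, b'))) \<inter> path_image (C ((x, d), (y, d')))"
      then obtain z z' where z: "z \<in> path_image (c (v, w))" "z' \<in> path_image (c (x, y))"
        "r = \<sigma> (b \<or> b') * s z" "r = \<sigma> (d \<or> d') * s z'"
        by (auto simp: im)
      note e1 = arcD[OF e(1)] and e2 = arcD[OF e(2)]
      have zz: "z = z'" "(b \<or> b') = (d \<or> d') \<or> z = p u"
        using s_eq[of "b \<or> b'" z "d \<or> d'" z'] z cD[OF e1(1-3)] cD[OF e2(1-3)] by auto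
      have "z \<in> p ` pverts G"
      \<comment> \<open>Two edges over the same edge of \<open>G\<close> lie in different copies and
        can meet only at \<open>u\<close>; edges over different edges of \<open>G\<close> meet over
        vertices.\<close>
      proof (cases "{v, w} = {x, y}")
        case True
        have "(b \<or> b') \<noteq> (d \<or> d')"
          using True e1 e2 e(3) by (auto simp: doubleton_eq_iff)
        then show ?thesis using zz inV by blast
      next
        case False
        then show ?thesis using plane_embedding_edges[OF emb e1(1) e2(1)] z zz by blast
      qed
      then have "z \<in> {p v, p w}" using plane_embedding_edge(5)[OF emb e1(1)] z by blast
      then have "r \<in> {P (v, b), P (w, b')}" using z ends[OF e(1)] by auto
      moreover have "(v, b) \<in> pverts ?H" "(w, b') \<in> pverts ?H" using e1 by (auto simp: doubled_def)
      ultimately show "r \<in> P ` pverts ?H" by auto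
    qed
    then show "\<forall>(u, v)\<in>parcs ?H. \<forall>(x, y)\<in>parcs ?H. {u, v} \<noteq> {x, y} \<longrightarrow>
      path_image (C (u, v)) \<inter> path_image (C (x, y)) \<subseteq> P ` pverts ?H"
      by (simp add: Ball_def split_paired_all)
  qed
  then show ?thesis by (auto simp: planar_def)
qed

section \<open>List colorings of the wheel and of \<open>K\<^sub>5\<close> minus an edge\<close>

lemma ex_avoiding:
  assumes "finite F" "card F < card A"
  shows "\<exists>x\<in>A. x \<notin> F"
  using assms by (meson card_mono not_le subsetI)

lemma card_remove_le: "card A \<le> Suc (card (A - {x}))"
  by (cases "x \<in> A") (auto simp: card_Diff_singleton)

text \<open>The 4-cycle is 2-choosable. A color common to the opposite lists \<open>A\<close> and
  \<open>C\<close> leaves one for \<open>B\<close> and for \<open>D\<close>. If \<open>A\<close> and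
  \<open>C\<close> are disjoint, two colors from each give four different pairs, and each of
  \<open>B\<close> and \<open>D\<close> can block only one of them.\<close>

lemma cycle4_list_coloring:
  fixes A B C D :: "'c set"
  assumes "2 \<le> card A" "2 \<le> card B" "2 \<le> card C" "2 \<le> card D"
  shows "\<exists>a\<in>A. \<exists>b\<in>B. \<exists>c\<in>C. \<exists>d\<in>D. a \<noteq> b \<and> b \<noteq> c \<and> c \<noteq> d \<and> d \<noteq> a"
proof -
  have two: "\<exists>x y. x \<in> X \<and> y \<in> X \<and> x \<noteq> y" if "2 \<le> card X" for X :: "'c set"
    using that by (metis card_2_iff' obtain_subset_with_card_n subsetD)
  show ?thesis
  proof (cases "A \<inter> C = {}")
    case False
    then obtain x where x: "x \<in> A" "x \<in> C" by blast
    obtain b d where "b \<in> B" "b \<noteq> x" "d \<in> D" "d \<noteq> x" using two assms by metis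
    then show ?thesis
      using x by (intro bexI[of _ x] bexI[of _ b] bexI[of _ d]) auto
  next
    case True
    obtain a a' where a: "a \<in> A" "a' \<in> A" "a \<noteq> a'" using two assms by metis
    obtain c c' where c: "c \<in> C" "c' \<in> C" "c \<noteq> c'" using two assms by metis
    obtain b b' where b: "b \<in> B" "b' \<in> B" "b \<noteq> b'" using two assms by metis
    obtain d d' where d: "d \<in> D" "d' \<in> D" "d \<noteq> d'" using two assms by metis
    have ne: "a \<noteq> c" "a \<noteq> c'" "a' \<noteq> c" "a' \<noteq> c'" using True a c by auto
    have "\<exists>x\<in>{a, a'}. \<exists>z\<in>{c, c'}. \<not> {b, b'} \<subseteq> {x, z} \<and> \<not> {d, d'} \<subseteq> {x, z}"
      using ne a c b d by auto
    then obtain x z y y' where "x \<in> {a, a'}" "z \<in> {c, c'}" "y \<in> {b, b'}" "y' \<in> {d, d'}"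
      "y \<noteq> x" "y \<noteq> z" "y' \<noteq> x" "y' \<noteq> z" by auto
    then have "x \<in> A" "z \<in> C" "y \<in> B" "y' \<in> D" "y \<noteq> x" "y \<noteq> z" "y' \<noteq> x" "y' \<noteq> z"
      using a b c d by auto
    then show ?thesis by (intro bexI[of _ x] bexI[of _ y] bexI[of _ z] bexI[of _ y']) auto
  qed
qed

lemma triangle_list_coloring:
  assumes "1 \<le> card X" "2 \<le> card Y" "3 \<le> card Z"
  shows "\<exists>x\<in>X. \<exists>y\<in>Y. \<exists>z\<in>Z. x \<noteq> y \<and> y \<noteq> z \<and> z \<noteq> x"
proof -
  obtain x where "x \<in> X" using assms by (metis card.empty ex_in_conv not_one_le_zero)
  moreover obtain y where "y \<in> Y" "y \<noteq> x" using ex_avoiding[of "{x}" Y] assms by auto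
  moreover obtain z where "z \<in> Z" "z \<noteq> x" "z \<noteq> y"
    using ex_avoiding[of "{x, y}" Z] assms \<open>y \<noteq> x\<close> by auto
  ultimately show ?thesis by (intro bexI[of _ x] bexI[of _ y] bexI[of _ z]) auto
qed

section \<open>The wheel: which list sizes suffice\<close>

definition wheel_colorable :: "'c set \<Rightarrow> 'c set \<Rightarrow> 'c set \<Rightarrow> 'c set \<Rightarrow> 'c set \<Rightarrow> bool" where
  "wheel_colorable H A B C D \<longleftrightarrow> (\<exists>h\<in>H. \<exists>a\<in>A. \<exists>b\<in>B. \<exists>c\<in>C. \<exists>d\<in>D.
     h \<notin> {a, b, c, d} \<and> a \<noteq> b \<and> b \<noteq> c \<and> c \<noteq> d \<and> d \<noteq> a)"

lemma wheel_colorableI: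
  assumes "h \<in> H" "a \<in> A" "b \<in> B" "c \<in> C" "d \<in> D" "h \<notin> {a, b, c, d}" "a \<noteq> b" "b \<noteq> c" "c \<noteq> d" "d \<noteq> a"
  shows "wheel_colorable H A B C D"
  unfolding wheel_colorable_def using assms
  by (intro bexI[of _ h] bexI[of _ a] bexI[of _ b] bexI[of _ c] bexI[of _ d]) auto

lemma wheel_colorableE:
  assumes "wheel_colorable H A B C D"
  obtains h a b c d where "h \<in> H" "a \<in> A" "b \<in> B" "c \<in> C" "d \<in> D"
    "h \<notin> {a, b, c, d}" "a \<noteq> b" "b \<noteq> c" "c \<noteq> d" "d \<noteq> a"
  using assms unfolding wheel_colorable_def by (elim bexE conjE)

lemma wheel_colorable_rotate:
  assumes "wheel_colorable H B C D A"
  shows "wheel_colorable H A B C D"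
  using assms
proof (rule wheel_colorableE)
  fix h b c d a
  assume "h \<in> H" "b \<in> B" "c \<in> C" "d \<in> D" "a \<in> A" "h \<notin> {b, c, d, a}" "b \<noteq> c" "c \<noteq> d" "d \<noteq> a" "a \<noteq> b"
  then show ?thesis by (intro wheel_colorableI[of h _ a _ b _ c _ d]) auto
qed

lemma wheel_colorable_mono:
  assumes "wheel_colorable H A B C D" "H \<subseteq> H'" "A \<subseteq> A'" "B \<subseteq> B'" "C \<subseteq> C'" "D \<subseteq> D'"
  shows "wheel_colorable H' A' B' C' D'"
  using assms(1)
proof (rule wheel_colorableE)
  fix h a b c d
  assume "h \<in> H" "a \<in> A" "b \<in> B" "c \<in> C" "d \<in> D" "h \<notin> {a, b, c, d}" "a \<noteq> b" "b \<noteq> c" "c \<noteq> d" "d \<noteq> a"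
  then show ?thesis using assms(2-6) by (intro wheel_colorableI[of h _ a _ b _ c _ d]) auto
qed

lemma wheel_colorable_hub:
  assumes "h \<in> H" "2 \<le> card (A - {h})" "2 \<le> card (B - {h})" "2 \<le> card (C - {h})" "2 \<le> card (D - {h})"
  shows "wheel_colorable H A B C D"
  using cycle4_list_coloring[OF assms(2-5)]
proof (elim bexE conjE)
  fix a b c d
  assume "a \<in> A - {h}" "b \<in> B - {h}" "c \<in> C - {h}" "d \<in> D - {h}" "a \<noteq> b" "b \<noteq> c" "c \<noteq> d" "d \<noteq> a"
  then show ?thesis using assms(1) by (intro wheel_colorableI[of h _ a _ b _ c _ d]) auto
qed

text \<open>Of three hub colors, one avoids two chosen colors of \<open>A\<close>. It costs the
  other rim lists at most one color each, so the 4-cycle keeps lists of size two.\<close>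

lemma wheel_colorable_one:
  assumes "finite H" "3 \<le> card H" "2 \<le> card A" "3 \<le> card B" "3 \<le> card C" "3 \<le> card D"
  shows "wheel_colorable H A B C D"
proof -
  obtain A' where A': "A' \<subseteq> A" "card A' = 2" "finite A'"
    using obtain_subset_with_card_n[OF assms(3)] by metis
  obtain h where h: "h \<in> H" "h \<notin> A'" using ex_avoiding[of A' H] A' assms by auto
  have "wheel_colorable H A' B C D"
    by (rule wheel_colorable_hub[OF h(1)])
      (use A' h assms card_remove_le[of B h] card_remove_le[of C h] card_remove_le[of D h] in auto)
  then show ?thesis by (rule wheel_colorable_mono) (use A' in auto)
qed

text \<open>A hub color outside both trimmed short lists reduces to the 4-cycle. The obstacle is a
  hub list that is exactly their disjoint union; the two conclusions are short lists on adjacent and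
  on opposite rim vertices.\<close>

lemma wheel_colorable_two:
  assumes fin: "finite H" and H: "4 \<le> card H"
    and cards: "2 \<le> card X" "2 \<le> card Y" "3 \<le> card Z" "3 \<le> card Z'"
  shows "wheel_colorable H X Y Z Z'" and "wheel_colorable H X Z Y Z'"
proof -
  obtain A where A: "A \<subseteq> X" "card A = 2" "finite A"
    using obtain_subset_with_card_n[OF cards(1)] by metis
  obtain C where C: "C \<subseteq> Y" "card C = 2" "finite C"
    using obtain_subset_with_card_n[OF cards(2)] by metis
  obtain B where B: "B \<subseteq> Z" "card B = 3" "finite B"
    using obtain_subset_with_card_n[OF cards(3)] by metis
  obtain D where D: "D \<subseteq> Z'" "card D = 3" "finite D"
    using obtain_subset_with_card_n[OF cards(4)] by metis
  have "wheel_colorable H A C B D \<and> wheel_colorable H A B C D"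
  proof (cases "H \<subseteq> A \<union> C")
    case False
    then obtain h where h: "h \<in> H" "h \<notin> A" "h \<notin> C" by blast
    have "2 \<le> card (A - {h})" "2 \<le> card (B - {h})" "2 \<le> card (C - {h})" "2 \<le> card (D - {h})"
      using A B C D h card_remove_le[of B h] card_remove_le[of D h] by auto
    then show ?thesis using wheel_colorable_hub[OF h(1)] by blast
  next
    case True
    have "4 \<le> card (A \<union> C)" using True H card_mono[of "A \<union> C" H] A C by auto
    then have "card (A \<inter> C) = 0" and cAC: "card (A \<union> C) = 4"
      using card_Un_Int[OF A(3) C(3)] A(2) C(2) by linarith+
    then have AC: "A \<inter> C = {}" using A by simp
    have HAC: "H = A \<union> C"
      using True H cAC A C by (metis card_seteq finite_UnI)
    obtain a a' where a: "A = {a, a'}" "a \<noteq> a'" using A by (meson card_2_iff)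
    obtain c c' where c: "C = {c, c'}" "c \<noteq> c'" using C by (meson card_2_iff)
    \<comment> \<open>Adjacent short lists: the hub color \<open>a\<close> leaves \<open>C\<close>
      intact, and the rim is colored from \<open>a'\<close> the other way round, ending in
      \<open>C\<close>.\<close>
    have "wheel_colorable H A C B D"
    proof -
      obtain x where x: "x \<in> D" "x \<notin> {a, a'}" using ex_avoiding[of "{a, a'}" D] a D by auto
      obtain y where y: "y \<in> B" "y \<notin> {a, x}" using ex_avoiding[of "{a, x}" B] x B by auto
      obtain z where z: "z \<in> C" "z \<noteq> y" using c by auto
      show ?thesis
        using a AC HAC x y z by (intro wheel_colorableI[of a _ a' _ z _ y _ x]) auto
    qed
    moreover have "wheel_colorable H A B C D"
    proof -
      \<comment> \<open>Opposite short lists: the hub takes a color of \<open>A\<close> if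
        \<open>x\<close> and \<open>y\<close> avoid \<open>A\<close> and do not exhaust
        \<open>C\<close>, and a color of \<open>C\<close> if \<open>x = y\<close> lies in
        \<open>A\<close>. If \<open>B\<close> and \<open>D\<close> stay within the four hub colors,
        they share a color, as 3 + 3 > 4.\<close>
      have "\<exists>x y. x \<in> B \<and> y \<in> D \<and> x \<notin> A \<and> y \<notin> A \<and> (x \<notin> C \<or> y \<notin> C \<or> x = y)
          \<or> x \<in> B \<and> y \<in> D \<and> x = y \<and> x \<in> A"
      proof -
        obtain x where x: "x \<in> B" "x \<notin> A" using ex_avoiding[of A B] A B by auto
        obtain y where y: "y \<in> D" "y \<notin> A" using ex_avoiding[of A D] A D by auto
        consider x' where "x' \<in> B" "x' \<notin> A \<union> C" | y' where "y' \<in> D" "y' \<notin> A \<union> C"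
          | "B \<union> D \<subseteq> A \<union> C" by blast
        then show ?thesis
        proof cases
          case 3
          then have "card (B \<union> D) \<le> 4" using cAC card_mono[of "A \<union> C" "B \<union> D"] A C by auto
          then have "B \<inter> D \<noteq> {}" using card_Un_Int[of B D] B D by auto
          then show ?thesis by blast
        qed (use x y in blast)+
      qed
      then obtain x y where xy: "x \<in> B" "y \<in> D" "x \<notin> A \<and> y \<notin> A \<and> (x \<notin> C \<or> y \<notin> C \<or> x = y)
          \<or> x = y \<and> x \<in> A" by blast
      then consider "x \<notin> A" "y \<notin> A" "x \<notin> C \<or> y \<notin> C \<or> x = y" | "x = y" "x \<in> A" by blast
      then show ?thesis
      proof cases
        case 1
        then obtain z where z: "z \<in> C" "z \<noteq> x" "z \<noteq> y" using c by auto
        show ?thesis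
          using 1 a AC HAC xy z by (intro wheel_colorableI[of a _ a' _ x _ z _ y]) auto
      next
        case 2
        then obtain z where z: "z \<in> A" "z \<noteq> x" using a by auto
        show ?thesis
          using 2 c AC HAC xy z by (intro wheel_colorableI[of c _ z _ x _ c' _ y]) auto
      qed
    qed
    ultimately show ?thesis by blast
  qed
  then show "wheel_colorable H X Y Z Z'" "wheel_colorable H X Z Y Z'"
    using A B C D wheel_colorable_mono[of H A C B D H X Y Z Z'] wheel_colorable_mono[of H A B C D H X Z Y Z']
    by auto
qed

section \<open>K5 minus an edge: which list sizes suffice\<close>

definition K5_minus_edge_colorable :: "'c set \<Rightarrow> 'c set \<Rightarrow> 'c set \<Rightarrow> 'c set \<Rightarrow> 'c set \<Rightarrow> bool" where
  "K5_minus_edge_colorable X Y Z A B \<longleftrightarrow> (\<exists>x\<in>X. \<exists>y\<in>Y. \<exists>z\<in>Z. \<exists>a\<in>A. \<exists>b\<in>B.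
     x \<noteq> y \<and> y \<noteq> z \<and> z \<noteq> x \<and> a \<notin> {x, y, z} \<and> b \<notin> {x, y, z})"

lemma K5_minus_edge_colorableI:
  assumes "x \<in> X" "y \<in> Y" "z \<in> Z" "a \<in> A" "b \<in> B"
    "x \<noteq> y" "y \<noteq> z" "z \<noteq> x" "a \<notin> {x, y, z}" "b \<notin> {x, y, z}"
  shows "K5_minus_edge_colorable X Y Z A B"
  unfolding K5_minus_edge_colorable_def using assms
  by (intro bexI[of _ x] bexI[of _ y] bexI[of _ z] bexI[of _ a] bexI[of _ b]) auto

lemma K5_minus_edge_colorableE:
  assumes "K5_minus_edge_colorable X Y Z A B"
  obtains x y z a b where "x \<in> X" "y \<in> Y" "z \<in> Z" "a \<in> A" "b \<in> B"
    "x \<noteq> y" "y \<noteq> z" "z \<noteq> x" "a \<notin> {x, y, z}" "b \<notin> {x, y, z}"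
  using assms unfolding K5_minus_edge_colorable_def by (elim bexE conjE)

lemma K5_minus_edge_colorable_mono:
  assumes "K5_minus_edge_colorable X Y Z A B" "X \<subseteq> X'" "Y \<subseteq> Y'" "Z \<subseteq> Z'" "A \<subseteq> A'" "B \<subseteq> B'"
  shows "K5_minus_edge_colorable X' Y' Z' A' B'"
  using assms(1)
proof (rule K5_minus_edge_colorableE)
  fix x y z a b
  assume "x \<in> X" "y \<in> Y" "z \<in> Z" "a \<in> A" "b \<in> B"
    "x \<noteq> y" "y \<noteq> z" "z \<noteq> x" "a \<notin> {x, y, z}" "b \<notin> {x, y, z}"
  then show ?thesis
    using assms(2-6) by (intro K5_minus_edge_colorableI[of x _ y _ z _ a _ b]) auto
qed

lemma K5_minus_edge_colorable_swap:
  assumes "K5_minus_edge_colorable X Y Z A B"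
  shows "K5_minus_edge_colorable X Y Z B A" "K5_minus_edge_colorable Y X Z A B"
    "K5_minus_edge_colorable X Z Y A B"
proof -
  obtain x y z a b where "x \<in> X" "y \<in> Y" "z \<in> Z" "a \<in> A" "b \<in> B"
    "x \<noteq> y" "y \<noteq> z" "z \<noteq> x" "a \<notin> {x, y, z}" "b \<notin> {x, y, z}"
    using assms by (rule K5_minus_edge_colorableE)
  then show "K5_minus_edge_colorable X Y Z B A" "K5_minus_edge_colorable Y X Z A B"
    "K5_minus_edge_colorable X Z Y A B"
    by (auto intro: K5_minus_edge_colorableI[of x _ y _ z _ b _ a] K5_minus_edge_colorableI[of y _ x _ z _ a _ b]
        K5_minus_edge_colorableI[of x _ z _ y _ a _ b])
qed

text \<open>The nonadjacent pair is colored beforehand; sizes 1, 2, 3 are what a greedy coloring of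
  the triangle consumes.\<close>

lemma K5_minus_edge_colorable_extend:
  assumes "a \<in> A" "b \<in> B"
    "1 \<le> card (X - {a, b})" "2 \<le> card (Y - {a, b})" "3 \<le> card (Z - {a, b})"
  shows "K5_minus_edge_colorable X Y Z A B"
  using triangle_list_coloring[OF assms(3-5)]
proof (elim bexE conjE)
  fix x y z
  assume "x \<in> X - {a, b}" "y \<in> Y - {a, b}" "z \<in> Z - {a, b}" "x \<noteq> y" "y \<noteq> z" "z \<noteq> x"
  then show ?thesis
    using assms(1,2) by (intro K5_minus_edge_colorableI[of x _ y _ z _ a _ b]) auto
qed

lemma card_remove2_le: "card A \<le> Suc (Suc (card (A - {x, y})))"
  using card_remove_le[of A x] card_remove_le[of "A - {x}" y] by (simp flip: Diff_insert2)

lemma card_remove2_le_notin: "x \<notin> A \<or> y \<notin> A \<or> x = y \<Longrightarrow> card A \<le> Suc (card (A - {x, y}))"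
proof -
  assume "x \<notin> A \<or> y \<notin> A \<or> x = y"
  then have "A - {x, y} = A - {x} \<or> A - {x, y} = A - {y}" by auto
  then show ?thesis using card_remove_le[of A x] card_remove_le[of A y] by (elim disjE) simp_all
qed

text \<open>The digits are the list sizes. A color common to \<open>A\<close> and \<open>B\<close>
  leaves 2, 2, 3 on the triangle. Otherwise 3 + 3 > 4 gives a color outside \<open>Z\<close>, say in
  \<open>A\<close>, and a partner in \<open>B\<close> can be chosen so that \<open>X\<close> loses
  at most one color as well; this leaves 2, 1, 3.\<close>

lemma K5_minus_edge_colorable_33433:
  assumes "3 \<le> card X" "3 \<le> card Y" "4 \<le> card Z" "3 \<le> card A" "3 \<le> card B"
  shows "K5_minus_edge_colorable X Y Z A B"
proof -
  have ex: "K5_minus_edge_colorable X Y Z A B"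
    if c: "card X = 3" "card Y = 3" "card Z = 4" "card A = 3" "card B = 3"
      and a: "a \<in> A" "a \<notin> Z" and disj: "A \<inter> B = {}" for a and X Y Z A B :: "'a set"
  proof -
    have fin: "finite X" "finite Y" "finite Z" "finite B" using c by (auto intro: card_ge_0_finite)
    obtain b where b: "b \<in> B" "a \<notin> X \<or> b \<notin> X"
    proof (cases "a \<in> X")
      case True
      then have "card (X - {a}) < card B" using c fin by simp
      then obtain b where "b \<in> B" "b \<notin> X - {a}" using ex_avoiding[of "X - {a}" B] fin by auto
      then show thesis using that a disj by blast
    next
      case False
      moreover have "B \<noteq> {}" using c by auto
      ultimately show thesis using that by blast
    qed
    have "K5_minus_edge_colorable Y X Z A B"
      by (rule K5_minus_edge_colorable_extend[OF a(1) b(1)])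
        (use c fin a b card_remove2_le[of Y a b] card_remove2_le_notin[of a X b]
          card_remove2_le_notin[of a Z b] in auto)
    then show ?thesis by (rule K5_minus_edge_colorable_swap)
  qed
  obtain X' where X': "X' \<subseteq> X" "card X' = 3" "finite X'"
    using obtain_subset_with_card_n[OF assms(1)] by metis
  obtain Y' where Y': "Y' \<subseteq> Y" "card Y' = 3" "finite Y'"
    using obtain_subset_with_card_n[OF assms(2)] by metis
  obtain Z' where Z': "Z' \<subseteq> Z" "card Z' = 4" "finite Z'"
    using obtain_subset_with_card_n[OF assms(3)] by metis
  obtain A' where A': "A' \<subseteq> A" "card A' = 3" "finite A'"
    using obtain_subset_with_card_n[OF assms(4)] by metis
  obtain B' where B': "B' \<subseteq> B" "card B' = 3" "finite B'"
    using obtain_subset_with_card_n[OF assms(5)] by metis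
  have "K5_minus_edge_colorable X' Y' Z' A' B'"
  proof (cases "A' \<inter> B' = {}")
    case False
    then obtain a where "a \<in> A'" "a \<in> B'" by blast
    then show ?thesis
      by (rule K5_minus_edge_colorable_extend)
        (use X' Y' Z' card_remove_le[of X' a] card_remove_le[of Y' a] card_remove_le[of Z' a] in auto)
  next
    case True
    then have "card Z' < card (A' \<union> B')" using A' B' Z' by (simp add: card_Un_disjoint)
    then obtain a where "a \<in> A' \<union> B'" and a: "a \<notin> Z'" using ex_avoiding Z' by blast
    then consider "a \<in> A'" | "a \<in> B'" by blast
    then show ?thesis
    proof cases
      case 1
      then show ?thesis by (rule ex[OF X'(2) Y'(2) Z'(2) A'(2) B'(2) _ a True])
    next
      case 2
      have "B' \<inter> A' = {}" using True by blast
      from ex[OF X'(2) Y'(2) Z'(2) B'(2) A'(2) 2 a this] show ?thesis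
        by (rule K5_minus_edge_colorable_swap)
    qed
  qed
  then show ?thesis
    by (rule K5_minus_edge_colorable_mono) (use X' Y' Z' A' B' in auto)
qed

text \<open>A common color of \<open>A\<close> and \<open>B\<close> leaves 2, 3, 3. Otherwise 2 + 3
  > 4 gives a pair that costs four colors of \<open>Z\<close> only one, leaving 1, 2, 3.\<close>

lemma K5_minus_edge_colorable_34423:
  assumes "3 \<le> card X" "4 \<le> card Y" "4 \<le> card Z" "2 \<le> card A" "3 \<le> card B"
  shows "K5_minus_edge_colorable X Y Z A B"
proof -
  have fin: "finite X" "finite Y" using assms by (auto intro: card_ge_0_finite)
  obtain Z' where Z': "Z' \<subseteq> Z" "card Z' = 4" "finite Z'"
    using obtain_subset_with_card_n[OF assms(3)] by metis
  have finAB: "finite A" "finite B" "A \<noteq> {}" "B \<noteq> {}" using assms by (auto intro: card_ge_0_finite)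
  have "K5_minus_edge_colorable X Y Z' A B"
  proof (cases "A \<inter> B = {}")
    case False
    then obtain a where "a \<in> A" "a \<in> B" by blast
    then show ?thesis
      by (rule K5_minus_edge_colorable_extend)
        (use assms fin Z' card_remove_le[of X a] card_remove_le[of Y a] card_remove_le[of Z' a] in auto)
  next
    case True
    then have "card Z' < card (A \<union> B)" using finAB assms Z' by (simp add: card_Un_disjoint)
    then obtain e where "e \<in> A \<union> B" "e \<notin> Z'" using ex_avoiding Z' by blast
    then obtain a b where ab: "a \<in> A" "b \<in> B" "a \<notin> Z' \<or> b \<notin> Z'" using finAB by blast
    show ?thesis
      by (rule K5_minus_edge_colorable_extend[OF ab(1,2)])
        (use assms fin Z' ab card_remove2_le[of X a b] card_remove2_le[of Y a b]
          card_remove2_le_notin[of a Z' b] in auto)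
  qed
  then show ?thesis
    by (rule K5_minus_edge_colorable_mono) (use Z' in auto)
qed

text \<open>The numbers are the deficits against full sizes 4 and 3. A deficient hub allows one
  deficient rim vertex, which is rotated to the front; otherwise two rim vertices are deficient,
  adjacent or opposite up to rotation.\<close>

lemma wheel_colorable_deficient:
  fixes n i j k l :: nat
  assumes fin: "finite H"
    and sum: "n + i + j + k + l \<le> 2" "n \<le> 1" "i \<le> 1" "j \<le> 1" "k \<le> 1" "l \<le> 1"
    and cards: "4 \<le> card H + n" "3 \<le> card A + i" "3 \<le> card B + j" "3 \<le> card C + k" "3 \<le> card D + l"
  shows "wheel_colorable H A B C D"
proof (cases "n = 1")
  case True
  then consider "j = 0" "k = 0" "l = 0" | "i = 0" "k = 0" "l = 0" | "i = 0" "j = 0" "l = 0"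
    | "i = 0" "j = 0" "k = 0" using sum by linarith
  then show ?thesis
  proof cases
    case 1
    with True cards sum show ?thesis by (intro wheel_colorable_one[OF fin]) auto
  next
    case 2
    with True cards sum have "wheel_colorable H B C D A" by (intro wheel_colorable_one[OF fin]) auto
    then show ?thesis by (rule wheel_colorable_rotate)
  next
    case 3
    with True cards sum have "wheel_colorable H C D A B" by (intro wheel_colorable_one[OF fin]) auto
    then show ?thesis by (rule wheel_colorable_rotate[OF wheel_colorable_rotate])
  next
    case 4
    with True cards sum have "wheel_colorable H D A B C" by (intro wheel_colorable_one[OF fin]) auto
    then show ?thesis
      by (rule wheel_colorable_rotate[OF wheel_colorable_rotate[OF wheel_colorable_rotate]])
  qed
next
  case False
  then have H: "4 \<le> card H" using cards sum by simp
  consider "k = 0" "l = 0" | "i = 0" "l = 0" | "i = 0" "j = 0" | "j = 0" "k = 0" | "j = 0" "l = 0"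
    | "i = 0" "k = 0" using sum by linarith
  then show ?thesis
  proof cases
    case 1
    with cards sum show ?thesis by (intro wheel_colorable_two(1)[OF fin H]) auto
  next
    case 2
    with cards sum have "wheel_colorable H B C D A" by (intro wheel_colorable_two(1)[OF fin H]) auto
    then show ?thesis by (rule wheel_colorable_rotate)
  next
    case 3
    with cards sum have "wheel_colorable H C D A B" by (intro wheel_colorable_two(1)[OF fin H]) auto
    then show ?thesis by (rule wheel_colorable_rotate[OF wheel_colorable_rotate])
  next
    case 4
    with cards sum have "wheel_colorable H D A B C" by (intro wheel_colorable_two(1)[OF fin H]) auto
    then show ?thesis
      by (rule wheel_colorable_rotate[OF wheel_colorable_rotate[OF wheel_colorable_rotate]])
  next
    case 5
    with cards sum show ?thesis by (intro wheel_colorable_two(2)[OF fin H]) auto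
  next
    case 6
    with cards sum have "wheel_colorable H B C D A" by (intro wheel_colorable_two(2)[OF fin H]) auto
    then show ?thesis by (rule wheel_colorable_rotate)
  qed
qed

text \<open>The bound \<open>m + n \<le> 1\<close> excludes the genuine exception: disjoint
  two-element lists \<open>A\<close> and \<open>B\<close> whose union is each of the triangle
  lists.\<close>

lemma K5_minus_edge_colorable_deficient:
  fixes i j k m n :: nat
  assumes sum: "i + j + k + m + n \<le> 2" "m + n \<le> 1" "i \<le> 1" "j \<le> 1" "k \<le> 1"
    and cards: "4 \<le> card X + i" "4 \<le> card Y + j" "4 \<le> card Z + k" "3 \<le> card A + m" "3 \<le> card B + n"
  shows "K5_minus_edge_colorable X Y Z A B"
proof (cases "m + n = 0")
  case True
  then consider "k = 0" | "j = 0" | "i = 0" using sum by linarith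
  then show ?thesis
  proof cases
    case 1
    with True cards sum show ?thesis by (intro K5_minus_edge_colorable_33433) auto
  next
    case 2
    with True cards sum have "K5_minus_edge_colorable X Z Y A B"
      by (intro K5_minus_edge_colorable_33433) auto
    then show ?thesis by (rule K5_minus_edge_colorable_swap)
  next
    case 3
    with True cards sum have "K5_minus_edge_colorable Y Z X A B"
      by (intro K5_minus_edge_colorable_33433) auto
    then have "K5_minus_edge_colorable Y X Z A B" by (rule K5_minus_edge_colorable_swap)
    then show ?thesis by (rule K5_minus_edge_colorable_swap)
  qed
next
  case False
  have light: "K5_minus_edge_colorable X Y Z A' B'" if "2 \<le> card A'" "3 \<le> card B'" for A' B' 
  proof -
    consider "j = 0" "k = 0" | "i = 0" "k = 0" | "i = 0" "j = 0" using sum False by linarith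
    then show ?thesis
    proof cases
      case 1
      with that cards sum show ?thesis by (intro K5_minus_edge_colorable_34423) auto
    next
      case 2
      with that cards sum have "K5_minus_edge_colorable Y X Z A' B'"
        by (intro K5_minus_edge_colorable_34423) auto
      then show ?thesis by (rule K5_minus_edge_colorable_swap)
    next
      case 3
      with that cards sum have "K5_minus_edge_colorable Z X Y A' B'"
        by (intro K5_minus_edge_colorable_34423) auto
      then have "K5_minus_edge_colorable X Z Y A' B'" by (rule K5_minus_edge_colorable_swap)
      then show ?thesis by (rule K5_minus_edge_colorable_swap)
    qed
  qed
  consider "m = 1" "n = 0" | "m = 0" "n = 1" using False sum by linarith
  then show ?thesis
  proof cases
    case 1
    with cards show ?thesis by (intro light) auto
  next
    case 2
    with cards have "K5_minus_edge_colorable X Y Z B A" by (intro light) auto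
    then show ?thesis by (rule K5_minus_edge_colorable_swap)
  qed
qed

section \<open>Minimal non-4-choosable planar graphs\<close>

text \<open>\<open>P\<close> is enlarged to half of the four colors, and the two halves are
  exchanged.\<close>

lemma ex_permutation_moving:
  assumes "card A = 4" "P \<subseteq> A" "card P \<le> 2"
  obtains \<pi> :: "'c \<Rightarrow> 'c" where "bij \<pi>" "\<pi> ` A = A" "\<pi> ` P \<inter> P = {}"
proof -
  have finA: "finite A" using assms by (simp add: card_ge_0_finite)
  obtain Q where Q: "P \<subseteq> Q" "Q \<subseteq> A" "card Q = 2"
    using exists_subset_between[of P 2 A] assms finA by auto
  then have "card (A - Q) = 2" using assms finA by (simp add: card_Diff_subset finite_subset)
  then obtain c d where cd: "A - Q = {c, d}" "c \<noteq> d" by (meson card_2_iff)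
  obtain a b where ab: "Q = {a, b}" "a \<noteq> b" using Q by (meson card_2_iff)
  have A: "A = {a, b, c, d}" "a \<noteq> c" "a \<noteq> d" "b \<noteq> c" "b \<noteq> d" using Q ab cd by auto
  let ?\<pi> = "Transposition.transpose a c \<circ> Transposition.transpose b d"
  have vals: "?\<pi> a = c" "?\<pi> b = d" "?\<pi> c = a" "?\<pi> d = b"
    using A ab cd by (auto simp: Transposition.transpose_def)
  show thesis
  proof (rule that)
    show "bij ?\<pi>" by (simp add: bij_comp)
    show "?\<pi> ` A = A" using vals A(1) by auto
    show "?\<pi> ` P \<inter> P = {}"
    proof -
      have "?\<pi> ` P \<subseteq> {c, d}" using Q ab vals by auto
      moreover have "P \<subseteq> {a, b}" using Q ab by simp
      moreover have "{c, d} \<inter> {a, b} = {}" using A by auto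
      ultimately show ?thesis by blast
    qed
  qed
qed

section \<open>Residual lists outside a partial coloring\<close>

lemma out_degree_eq_card: "out_degree (with_proj G) v = card (parcs G `` {v})"
proof -
  have "parcs G `` {v} = snd ` out_arcs (with_proj G) v"
    by (force simp: out_arcs_def)
  moreover have "inj_on snd (out_arcs (with_proj G) v)"
    by (auto simp: out_arcs_def inj_on_def)
  ultimately show ?thesis by (simp add: out_degree_def card_image)
qed

lemma finite_neighbours: "pair_graph G \<Longrightarrow> finite (parcs G `` {v})"
  by (rule finite_subset[of _ "pverts G"]) (auto simp: pair_graph_iff)

lemma list_coloring_glue:
  assumes G: "pair_graph G" and f: "list_coloring (induced G (pverts G - S)) L f"
    and g: "\<And>v. v \<in> S \<Longrightarrow> g v \<in> L v - f ` (parcs G `` {v} - S)"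
      "\<And>u v. u \<in> S \<Longrightarrow> v \<in> S \<Longrightarrow> (u, v) \<in> parcs G \<Longrightarrow> g u \<noteq> g v"
  shows "list_coloring G L (\<lambda>v. if v \<in> S then g v else f v)"
proof -
  have 1: "f v \<in> L v" if "v \<in> pverts G" "v \<notin> S" for v
    using f that by (auto simp: list_coloring_def)
  have 2: "f u \<noteq> f v" if "(u, v) \<in> parcs G" "u \<notin> S" "v \<notin> S" for u v
    using f that G by (fastforce simp: list_coloring_def pair_graph_iff)
  have 3: "g u \<noteq> f v" if "(u, v) \<in> parcs G" "u \<in> S" "v \<notin> S" for u v
    using g(1)[of u] that by auto
  have 4: "f u \<noteq> g v" if "(u, v) \<in> parcs G" "u \<notin> S" "v \<in> S" for u v
    using 3[of v u] that G by (metis pair_graph_iff symD)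
  show ?thesis
    unfolding list_coloring_def using 1 2 3 4 g by (auto split: if_split_asm)
qed

lemma choosable_induced:
  assumes min: "minimal_non_4_choosable_planar G" and U: "U \<subset> pverts G"
  shows "choosable 4 (induced G U)"
proof -
  obtain p c where "plane_embedding G p c" and G: "pair_graph G"
    using min by (auto simp: minimal_non_4_choosable_planar_def planar_def)
  then have "planar (induced G U)" "pair_graph (induced G U)"
    using planar_induced pair_graph_induced U by blast+
  moreover have "card (pverts (induced G U)) < card (pverts G)"
    using U G by (simp add: pair_graph_iff psubset_card_mono)
  ultimately show ?thesis using choosable_smaller[OF min] by blast
qed

text \<open>A list loses at most one color for each neighbor outside \<open>S\<close>; the bound is
  additive to avoid truncated subtraction. A proper choice from the residual lists would complete a
  coloring of \<open>G\<close>, hence the last property.\<close>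

lemma uncolorable_residual_lists:
  assumes min: "minimal_non_4_choosable_planar G" and S: "S \<subseteq> pverts G" "S \<noteq> {}"
  obtains R :: "'a \<Rightarrow> nat set" where
    "\<And>v. v \<in> S \<Longrightarrow> finite (R v)"
    "\<And>v. v \<in> S \<Longrightarrow> 4 + card (parcs G `` {v} \<inter> S) \<le> card (R v) + out_degree (with_proj G) v"
    "\<And>g. (\<And>v. v \<in> S \<Longrightarrow> g v \<in> R v) \<Longrightarrow> \<exists>u\<in>S. \<exists>v\<in>S. (u, v) \<in> parcs G \<and> g u = g v"
proof -
  have G: "pair_graph G" and "\<not> choosable 4 G"
    using min by (auto simp: minimal_non_4_choosable_planar_def)
  then obtain L :: "'a \<Rightarrow> nat set" where L: "\<And>v. v \<in> pverts G \<Longrightarrow> finite (L v) \<and> card (L v) = 4"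
    and nc: "\<And>f. \<not> list_coloring G L f" unfolding choosable_def by blast
  have "choosable 4 (induced G (pverts G - S))"
    using choosable_induced[OF min, of "pverts G - S"] S by blast
  then obtain f where f: "list_coloring (induced G (pverts G - S)) L f"
    unfolding choosable_def using L by (metis DiffD1 induced_simps(1))
  define R where "R v = L v - f ` (parcs G `` {v} - S)" for v
  show thesis
  proof (rule that)
    fix v assume v: "v \<in> S"
    then show "finite (R v)" using L S by (auto simp: R_def)
    have fin: "finite (parcs G `` {v})" using finite_neighbours[OF G] .
    have "card (L v) \<le> card (R v) + card (f ` (parcs G `` {v} - S))"
      unfolding R_def using diff_card_le_card_Diff[of "f ` (parcs G `` {v} - S)" "L v"] fin by simp
    moreover have "card (f ` (parcs G `` {v} - S)) \<le> card (parcs G `` {v} - S)"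
      using fin by (simp add: card_image_le)
    moreover have "card (parcs G `` {v}) = card (parcs G `` {v} \<inter> S) + card (parcs G `` {v} - S)"
      using card_Int_Diff[OF fin] .
    ultimately show "4 + card (parcs G `` {v} \<inter> S) \<le> card (R v) + out_degree (with_proj G) v"
      using L[of v] v S by (auto simp: out_degree_eq_card)
  next
    fix g :: "'a \<Rightarrow> nat" assume "\<And>v. v \<in> S \<Longrightarrow> g v \<in> R v"
    then show "\<exists>u\<in>S. \<exists>v\<in>S. (u, v) \<in> parcs G \<and> g u = g v"
      using list_coloring_glue[OF G f, of g] nc unfolding R_def by blast
  qed
qed

section \<open>Colors of a vertex that extend to a subgraph\<close>

definition extendable_colors :: "'a pair_pre_digraph \<Rightarrow> ('a \<Rightarrow> 'c set) \<Rightarrow> 'a \<Rightarrow> 'c set" where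
  "extendable_colors G L x = {f x | f. list_coloring G L f}"

lemma extendable_colorsI: "list_coloring G L f \<Longrightarrow> f x = a \<Longrightarrow> a \<in> extendable_colors G L x"
  by (auto simp: extendable_colors_def)

lemma extendable_colors_subset: "x \<in> pverts G \<Longrightarrow> extendable_colors G L x \<subseteq> L x"
  by (auto simp: extendable_colors_def list_coloring_def)

text \<open>\<open>U - {x}\<close> is colorable by minimality, and at most two neighbors of
  \<open>x\<close> forbid at most two of its four colors.\<close>

lemma two_extendable_colors:
  assumes min: "minimal_non_4_choosable_planar G" and U: "U \<subseteq> pverts G" "x \<in> U"
    and nb: "card (parcs G `` {x} \<inter> U) \<le> 2"
    and L: "\<And>v. v \<in> pverts G \<Longrightarrow> finite (L v) \<and> card (L v) = 4"
  shows "2 \<le> card (extendable_colors (induced G U) L (x :: 'a) :: nat set)"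
proof -
  let ?H = "induced G U"
  have G: "pair_graph G" using min by (auto simp: minimal_non_4_choosable_planar_def)
  have H: "pair_graph ?H" using pair_graph_induced[OF G U(1)] .
  have "choosable 4 (induced G (U - {x}))"
    using choosable_induced[OF min, of "U - {x}"] U by blast
  then obtain f where f: "list_coloring (induced G (U - {x})) L f"
    unfolding choosable_def using L U by (metis DiffD1 induced_simps(1) subsetD)
  have eq: "induced G (U - {x}) = induced ?H (pverts ?H - {x})"
    by (auto simp: induced_def)
  let ?N = "parcs G `` {x} \<inter> U"
  have irr: "(x, x) \<notin> parcs G" using G by (auto simp: pair_graph_iff irrefl_def)
  have fin: "finite ?N" using finite_neighbours[OF G] by blast
  have sub: "L x - f ` ?N \<subseteq> extendable_colors ?H L x"
  proof
    fix a assume a: "a \<in> L x - f ` ?N"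
    have "list_coloring ?H L (\<lambda>v. if v \<in> {x} then a else f v)"
      using a f irr unfolding eq
      by (intro list_coloring_glue[OF H]) auto
    then show "a \<in> extendable_colors ?H L x"
      by (rule extendable_colorsI) simp
  qed
  have Lx: "finite (L x)" "card (L x) = 4" using L U by auto
  have "finite (extendable_colors ?H L x)"
    using extendable_colors_subset[of x ?H L] U Lx finite_subset by auto
  from card_mono[OF this sub] have "card (L x - f ` ?N) \<le> card (extendable_colors ?H L x)" .
  moreover have "card (L x) - card (f ` ?N) \<le> card (L x - f ` ?N)"
    using fin by (intro diff_card_le_card_Diff) simp
  moreover have "card (f ` ?N) \<le> 2" using card_image_le[OF fin, of f] nb by simp
  ultimately show ?thesis using Lx by simp
qed

text \<open>If at most two colors of \<open>x\<close> extend, a permutation of the colors gives a second copy of the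
  lists for which none of them does; two copies sharing \<open>x\<close> then form a smaller counterexample.\<close>

lemma three_extendable_colors:
  fixes L :: "'a \<Rightarrow> nat set"
  assumes min: "minimal_non_4_choosable_planar G" and emb: "plane_embedding G p c"
    and U: "U \<subseteq> pverts G" "x \<in> U" and h: "(x, h) \<in> parcs G" "h \<notin> U"
    and small: "2 * card U \<le> card (pverts G)"
    and L: "\<And>v. v \<in> pverts G \<Longrightarrow> finite (L v) \<and> card (L v) = 4"
  shows "3 \<le> card (extendable_colors (induced G U) L x)"
proof (rule ccontr)
  let ?H = "induced G U" and ?P = "extendable_colors (induced G U) L x"
  assume "\<not> 3 \<le> card ?P"
  have G: "pair_graph G" using min by (auto simp: minimal_non_4_choosable_planar_def)
  have finU: "finite U" using G U by (auto simp: pair_graph_iff finite_subset)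
  have P: "?P \<subseteq> L x" using extendable_colors_subset[of x ?H L] U by simp
  obtain \<pi> where \<pi>: "bij \<pi>" "\<pi> ` L x = L x" "\<pi> ` ?P \<inter> ?P = {}"
    using ex_permutation_moving[OF _ P] L[of x] U \<open>\<not> 3 \<le> card ?P\<close> by (metis not_less_eq_eq numeral_2_eq_2 numeral_3_eq_3 subsetD)
  \<comment> \<open>The shared vertex has list \<open>L x\<close>, which \<pi> maps to itself, so
    both copies prescribe the same list there.\<close>
  define L' where "L' = (\<lambda>(v, b). if b then \<pi> ` L v else L v)"
  have "card (pverts (doubled ?H x)) < card (pverts G)"
    using card_doubled[of ?H x] finU U small card_gt_0_iff[of U] by auto
  then have "choosable 4 (doubled ?H x)"
    using choosable_smaller[OF min pair_graph_doubled[OF pair_graph_induced[OF G U(1)]]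
        planar_doubled[OF emb G U h]] by blast
  moreover have "\<forall>v\<in>pverts (doubled ?H x). finite (L' v) \<and> card (L' v) = 4"
  proof -
    have "card (\<pi> ` X) = card X" for X using \<pi>(1) by (meson bij_is_inj card_image inj_on_subset subset_UNIV)
    then show ?thesis using L U by (auto simp: L'_def doubled_def)
  qed
  ultimately obtain f where f: "list_coloring (doubled ?H x) L' f"
    unfolding choosable_def by blast
  have fL: "f (v, b) \<in> L' (v, b)" if "v \<in> U" "v = x \<longrightarrow> \<not> b" for v b
    using f that by (auto simp: list_coloring_def doubled_def)
  have fE: "f (v, b) \<noteq> f (w, b')" if "(v, w) \<in> parcs G" "v \<in> U" "w \<in> U" "v = x \<longrightarrow> \<not> b"
    "w = x \<longrightarrow> \<not> b'" "b = b' \<or> v = x \<or> w = x" for v b w b'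
  proof -
    have "((v, b), (w, b')) \<in> parcs (doubled ?H x)" using that by (auto simp: doubled_def)
    then show ?thesis using f by (auto simp: list_coloring_def)
  qed
  have "list_coloring ?H L (\<lambda>v. f (v, False))"
    using fL[of _ False] fE[of _ _ False False] by (auto simp: list_coloring_def L'_def)
  then have "f (x, False) \<in> ?P" by (auto simp: extendable_colors_def)
  moreover have "f (x, False) \<in> \<pi> ` ?P"
  proof -
    \<comment> \<open>The tag \<open>v \<noteq> x\<close> selects the second copy and gives
      \<open>x\<close> its only representative; the inverse of \<pi> turns its coloring into one
      from \<open>L\<close>.\<close>
    let ?g = "\<lambda>v. inv \<pi> (f (v, v \<noteq> x))"
    have "?g v \<in> L v" if "v \<in> U" for v
    proof -
      have "f (v, v \<noteq> x) \<in> \<pi> ` L v"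
        using fL[of v "v \<noteq> x"] that \<pi>(2) by (auto simp: L'_def split: if_splits)
      then show ?thesis using \<pi>(1) by (auto simp: bij_is_inj)
    qed
    moreover have "?g v \<noteq> ?g w" if "(v, w) \<in> parcs G" "v \<in> U" "w \<in> U" for v w
    proof -
      have "f (v, v \<noteq> x) \<noteq> f (w, w \<noteq> x)" using that by (intro fE) auto
      then show ?thesis using bij_imp_bij_inv[OF \<pi>(1)] by (simp add: bij_is_inj inj_eq)
    qed
    ultimately have "list_coloring ?H L ?g" by (auto simp: list_coloring_def)
    then have "?g x \<in> ?P" by (rule extendable_colorsI) simp
    then have "\<pi> (?g x) \<in> \<pi> ` ?P" by blast
    then show ?thesis using \<pi>(1) by (simp add: bij_is_surj surj_f_inv_f)
  qed
  ultimately show False using \<pi>(3) by blast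
qed

lemma no_bare_separating_triangle:
  assumes min: "minimal_non_4_choosable_planar G" and emb: "plane_embedding G p c"
    and dist: "distinct [a, b, d, x, y]"
    and edges: "{(a, b), (a, d), (b, d), (x, a), (x, b), (x, d), (y, a), (y, b), (y, d)} \<subseteq> parcs G"
    and nb: "\<And>t. t \<in> {a, b, d} \<Longrightarrow> parcs G `` {t} \<subseteq> {a, b, d, x, y}"
    and deg: "card (parcs G `` {x}) \<le> 5" "card (parcs G `` {y}) \<le> 5"
  shows False
proof -
  have G: "pair_graph G" and "\<not> choosable 4 G"
    using min by (auto simp: minimal_non_4_choosable_planar_def)
  then obtain L :: "'a \<Rightarrow> nat set" where L: "\<And>v. v \<in> pverts G \<Longrightarrow> finite (L v) \<and> card (L v) = 4"
    and nc: "\<And>f. \<not> list_coloring G L f" unfolding choosable_def by blast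
  have finV: "finite (pverts G)" using G by (simp add: pair_graph_iff)
  have sy: "(v, u) \<in> parcs G" if "(u, v) \<in> parcs G" for u v
    using that G by (auto simp: pair_graph_iff dest: symD)
  have V: "{a, b, d, x, y} \<subseteq> pverts G" using edges G by (auto simp: pair_graph_iff)
  let ?T = "{a, b, d}"
  define V' where "V' = pverts G - ?T"
  \<comment> \<open>\<open>A\<close> is the component of \<open>x\<close> after removal of the
    triangle; \<open>B\<close> is all the rest, possibly several components.\<close>
  define A where "A = (parcs G \<inter> V' \<times> V')\<^sup>* `` {x}"
  define B where "B = V' - A"
  have xV: "x \<in> V'" "y \<in> V'" using V dist by (auto simp: V'_def)
  have A: "x \<in> A" "A \<subseteq> V'"
    unfolding A_def using xV by (auto elim: rtranclE)
  have "(x, y) \<notin> (parcs G \<inter> V' \<times> V')\<^sup>*"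
    using separating_triangle[OF emb G dist edges] xV by (simp add: V'_def)
  then have B: "y \<in> B" using xV by (simp add: B_def A_def)
  have AB: "A \<inter> B = {}" "A \<union> B = V'" using A by (auto simp: B_def)
  have noedge: "(u, v) \<notin> parcs G" "(v, u) \<notin> parcs G" if "u \<in> A" "v \<in> B" for u v
  proof -
    show *: "(u, v) \<notin> parcs G"
    proof
      assume "(u, v) \<in> parcs G"
      then have "v \<in> A" using that A unfolding A_def B_def by (auto intro: rtrancl_into_rtrancl)
      then show False using that by (auto simp: B_def)
    qed
    then show "(v, u) \<notin> parcs G" using sy by blast
  qed
  have card: "card A + card B + 3 = card (pverts G)"
  proof -
    have "card V' = card A + card B"
      using AB finV by (metis V'_def card_Un_disjoint finite_Diff finite_Un)
    moreover have "card V' = card (pverts G) - 3"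
      unfolding V'_def using V dist by (subst card_Diff_subset) auto
    moreover have "3 \<le> card (pverts G)"
      using card_mono[OF finV, of ?T] V dist by auto
    ultimately show ?thesis by simp
  qed
  have sub: "A \<subseteq> pverts G" "B \<subseteq> pverts G" using AB by (auto simp: V'_def)
  \<comment> \<open>Three of the at most five neighbors are the triangle vertices.\<close>
  have few: "card (parcs G `` {v} \<inter> U) \<le> 2"
    if "card (parcs G `` {v}) \<le> 5" "?T \<subseteq> parcs G `` {v}" "U \<inter> ?T = {}" for v U
  proof -
    have "parcs G `` {v} \<inter> U \<subseteq> parcs G `` {v} - ?T" using that by blast
    then have "card (parcs G `` {v} \<inter> U) \<le> card (parcs G `` {v} - ?T)"
      using finite_neighbours[OF G] by (intro card_mono) auto
    also have "\<dots> = card (parcs G `` {v}) - 3"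
      using that dist by (subst card_Diff_subset) auto
    finally show ?thesis using that by simp
  qed
  let ?P = "extendable_colors (induced G A) L x" and ?Q = "extendable_colors (induced G B) L y"
  have disjT: "A \<inter> ?T = {}" "B \<inter> ?T = {}" using AB by (auto simp: V'_def)
  have P2: "2 \<le> card ?P" and Q2: "2 \<le> card ?Q"
    using two_extendable_colors[OF min sub(1) A(1) few[OF deg(1) _ disjT(1)] L]
      two_extendable_colors[OF min sub(2) B few[OF deg(2) _ disjT(2)] L] edges by auto
  \<comment> \<open>If \<alpha> and \<beta> coincide or one is missing from \<open>L a\<close>, the
    triangle keeps lists of sizes 3, 2, 2 and can be colored. Hence \<open>?P\<close> and
    \<open>?Q\<close> share out the four colors of \<open>L a\<close>.\<close>
  have key: "\<alpha> \<noteq> \<beta> \<and> \<alpha> \<in> L a \<and> \<beta> \<in> L a" if PQ: "\<alpha> \<in> ?P" "\<beta> \<in> ?Q" for \<alpha> \<beta>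
  proof (rule ccontr)
    assume bad: "\<not> (\<alpha> \<noteq> \<beta> \<and> \<alpha> \<in> L a \<and> \<beta> \<in> L a)"
    obtain f where f: "list_coloring (induced G A) L f" "f x = \<alpha>"
      using PQ by (auto simp: extendable_colors_def)
    obtain g where g: "list_coloring (induced G B) L g" "g y = \<beta>"
      using PQ by (auto simp: extendable_colors_def)
    define k where "k v = (if v \<in> A then f v else g v)" for v
    have fE: "f u \<noteq> f v" if "(u, v) \<in> parcs G" "u \<in> A" "v \<in> A" for u v
      using f(1) that by (auto simp: list_coloring_def)
    have gE: "g u \<noteq> g v" if "(u, v) \<in> parcs G" "u \<in> B" "v \<in> B" for u v
      using g(1) that by (auto simp: list_coloring_def)
    have "\<forall>v\<in>A. f v \<in> L v" "\<forall>v\<in>B. g v \<in> L v" using f(1) g(1) by (auto simp: list_coloring_def)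
    then have k: "list_coloring (induced G (pverts G - ?T)) L k"
      using fE gE AB noedge unfolding V'_def[symmetric]
      by (auto simp: list_coloring_def k_def split: if_split_asm)
    have kxy: "k x = \<alpha>" "k y = \<beta>" using f g A B AB by (auto simp: k_def)
    have "3 \<le> card (L a - {\<alpha>, \<beta>})" "2 \<le> card (L b - {\<alpha>, \<beta>})" "2 \<le> card (L d - {\<alpha>, \<beta>})"
      using bad card_remove2_le_notin[of \<alpha> "L a" \<beta>] card_remove2_le[of "L b" \<alpha> \<beta>]
        card_remove2_le[of "L d" \<alpha> \<beta>] L[of a] L[of b] L[of d] V by auto
    then obtain ca cb cd where col: "ca \<in> L a - {\<alpha>, \<beta>}" "cb \<in> L b - {\<alpha>, \<beta>}" "cd \<in> L d - {\<alpha>, \<beta>}"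
      "cb \<noteq> cd" "cd \<noteq> ca" "ca \<noteq> cb"
      using triangle_list_coloring[of "L b - {\<alpha>, \<beta>}" "L d - {\<alpha>, \<beta>}" "L a - {\<alpha>, \<beta>}"] by auto
    define m where "m = (\<lambda>v. if v = a then ca else if v = b then cb else cd)"
    have "list_coloring G L (\<lambda>v. if v \<in> ?T then m v else k v)"
    proof (rule list_coloring_glue[OF G k])
      fix v assume v: "v \<in> ?T"
      have "k ` (parcs G `` {v} - ?T) \<subseteq> {\<alpha>, \<beta>}" using nb[OF v] kxy by auto
      moreover have "m v \<in> L v - {\<alpha>, \<beta>}" using v col dist by (auto simp: m_def)
      ultimately show "m v \<in> L v - k ` (parcs G `` {v} - ?T)" by blast
    next
      fix u v assume "u \<in> ?T" "v \<in> ?T" "(u, v) \<in> parcs G"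
      moreover have "u \<noteq> v" using \<open>(u, v) \<in> parcs G\<close> G by (auto simp: pair_graph_iff irrefl_def)
      ultimately show "m u \<noteq> m v" using col dist by (auto simp: m_def)
    qed
    then show False using nc by blast
  qed
  have fin: "finite (L a)" "card (L a) = 4" using L V by auto
  have "?P \<noteq> {}" "?Q \<noteq> {}" using P2 Q2 by auto
  then have PQ: "?P \<subseteq> L a" "?Q \<subseteq> L a" "?P \<inter> ?Q = {}" using key by blast+
  have le: "card ?P + card ?Q \<le> 4"
  proof -
    have "card (?P \<union> ?Q) \<le> 4" using card_mono[of "L a" "?P \<union> ?Q"] PQ fin by simp
    then show ?thesis using PQ fin by (simp add: card_Un_disjoint finite_subset)
  qed
  show False
  proof (cases "card A \<le> card B")
    case True
    have "3 \<le> card ?P"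
      \<comment> \<open>The edge from \<open>x\<close> to \<open>a\<close>, which leaves
        \<open>A\<close>, is the cut along which the square root is taken.\<close>
      by (rule three_extendable_colors[OF min emb sub(1) A(1), of a])
        (use edges disjT L card True in auto)
    then show False using le Q2 by simp
  next
    case False
    have "3 \<le> card ?Q"
      by (rule three_extendable_colors[OF min emb sub(2) B, of a])
        (use edges disjT L card False in auto)
    then show False using le P2 by simp
  qed
qed

section \<open>The configurations by number of rim chords\<close>

text \<open>For degrees up to 5 the truncated difference \<open>deg v - 4\<close> is the indicator
  of degree 5; smaller degrees contribute nothing.\<close>

lemma sum_excess:
  fixes deg :: "'a \<Rightarrow> nat"
  assumes "card {v \<in> S. deg v = 5} \<le> 2" "\<And>v. v \<in> S \<Longrightarrow> deg v \<le> 5"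
    and "distinct [a, b, c, d, e]" "S = {a, b, c, d, e}"
  shows "(deg a - 4) + (deg b - 4) + (deg c - 4) + (deg d - 4) + (deg e - 4) \<le> 2"
proof -
  have "card {v \<in> S. deg v = 5} = (\<Sum>v\<in>S. if deg v = 5 then 1 else 0)"
    using assms(4) by (simp add: sum.If_cases Int_def)
  also have "\<dots> = (\<Sum>v\<in>S. deg v - 4)"
  proof (rule sum.cong)
    show "(if deg v = 5 then 1 else 0) = deg v - 4" if "v \<in> S" for v
      using assms(2)[OF that] by auto
  qed simp
  also have "\<dots> = (deg a - 4) + (deg b - 4) + (deg c - 4) + (deg d - 4) + (deg e - 4)"
    using assms(3,4) by simp
  finally show ?thesis using assms(1) by simp
qed

lemma K5_minus_edge_three_degree_5:
  assumes min: "minimal_non_4_choosable_planar G" and emb: "plane_embedding G p c"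
    and dist: "distinct [a, b, d, x, y]" and S: "S = {a, b, d, x, y}"
    and edges: "{(a, b), (a, d), (b, d), (x, a), (x, b), (x, d), (y, a), (y, b), (y, d)} \<subseteq> parcs G"
    and xy: "(x, y) \<notin> parcs G"
    and deg: "\<And>v. v \<in> S \<Longrightarrow> out_degree (with_proj G) v \<le> 5"
  shows "3 \<le> card {v \<in> S. out_degree (with_proj G) v = 5}"
proof (rule ccontr)
  let ?deg = "out_degree (with_proj G)"
  assume "\<not> 3 \<le> card {v \<in> S. ?deg v = 5}"
  then have sum2: "(?deg a - 4) + (?deg b - 4) + (?deg d - 4) + (?deg x - 4) + (?deg y - 4) \<le> 2"
    using sum_excess[where deg = ?deg, OF _ deg dist S] by simp
  have G: "pair_graph G" using min by (auto simp: minimal_non_4_choosable_planar_def)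
  have sy: "(v, u) \<in> parcs G" if "(u, v) \<in> parcs G" for u v
    using that G by (auto simp: pair_graph_iff dest: symD)
  have irr: "(v, v) \<notin> parcs G" for v using G by (auto simp: pair_graph_iff irrefl_def)
  have V: "S \<subseteq> pverts G" "S \<noteq> {}" using edges G S by (auto simp: pair_graph_iff)
  have yx: "(y, x) \<notin> parcs G" using sy xy by blast
  have nbs: "parcs G `` {a} \<inter> S = {b, d, x, y}" "parcs G `` {b} \<inter> S = {a, d, x, y}"
    "parcs G `` {d} \<inter> S = {a, b, x, y}" "parcs G `` {x} \<inter> S = {a, b, d}" "parcs G `` {y} \<inter> S = {a, b, d}"
    using edges edges[THEN subsetD, THEN sy] irr xy yx S by auto
  have inS: "a \<in> S" "b \<in> S" "d \<in> S" "x \<in> S" "y \<in> S" using S by auto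
  note deg' = deg[OF inS(1)] deg[OF inS(2)] deg[OF inS(3)] deg[OF inS(4)] deg[OF inS(5)]
  show False
  proof (cases "?deg x = 5 \<and> ?deg y = 5")
    case True
    then have deg4: "?deg a \<le> 4" "?deg b \<le> 4" "?deg d \<le> 4" using sum2 by auto
    have "parcs G `` {t} \<subseteq> {a, b, d, x, y}" if t: "t \<in> {a, b, d}" for t
    proof -
      \<comment> \<open>\<open>x\<close> and \<open>y\<close> use up both vertices of degree 5, and
        the four neighbors within \<open>S\<close> already fill the degree of
        \<open>t\<close>.\<close>
      have "card (parcs G `` {t}) \<le> card (parcs G `` {t} \<inter> S)"
        using deg4 t nbs dist by (auto simp: out_degree_eq_card)
      then have "parcs G `` {t} \<inter> S = parcs G `` {t}"
        using finite_neighbours[OF G] by (intro card_seteq) auto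
      then show ?thesis using S by blast
    qed
    then show False
      using no_bare_separating_triangle[OF min emb dist edges] deg'
      by (simp add: out_degree_eq_card)
  next
    case False
    obtain R :: "'a \<Rightarrow> nat set" where
      R: "\<And>v. v \<in> S \<Longrightarrow> finite (R v)"
      "\<And>v. v \<in> S \<Longrightarrow> 4 + card (parcs G `` {v} \<inter> S) \<le> card (R v) + ?deg v"
      "\<And>g. (\<And>v. v \<in> S \<Longrightarrow> g v \<in> R v) \<Longrightarrow> \<exists>u\<in>S. \<exists>v\<in>S. (u, v) \<in> parcs G \<and> g u = g v"
      using uncolorable_residual_lists[OF min V] by blast
    have "4 \<le> card (R a) + (?deg a - 4)" "4 \<le> card (R b) + (?deg b - 4)"
      "4 \<le> card (R d) + (?deg d - 4)" "3 \<le> card (R x) + (?deg x - 4)" "3 \<le> card (R y) + (?deg y - 4)"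
      using R(2)[OF inS(1)] R(2)[OF inS(2)] R(2)[OF inS(3)] R(2)[OF inS(4)] R(2)[OF inS(5)] nbs dist
      by auto
    moreover have "(?deg x - 4) + (?deg y - 4) \<le> 1" using False deg' by linarith
    ultimately have "K5_minus_edge_colorable (R a) (R b) (R d) (R x) (R y)"
      using sum2 deg' by (intro K5_minus_edge_colorable_deficient[of "?deg a - 4" "?deg b - 4" "?deg d - 4"
            "?deg x - 4" "?deg y - 4"]) linarith+
    then obtain ka kb kd kx ky where k: "ka \<in> R a" "kb \<in> R b" "kd \<in> R d" "kx \<in> R x" "ky \<in> R y"
      "ka \<noteq> kb" "kb \<noteq> kd" "kd \<noteq> ka" "kx \<notin> {ka, kb, kd}" "ky \<notin> {ka, kb, kd}"
      by (rule K5_minus_edge_colorableE)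
    define g where "g = (\<lambda>_. ky)(a := ka, b := kb, d := kd, x := kx)"
    have g: "g a = ka" "g b = kb" "g d = kd" "g x = kx" "g y = ky" using dist by (auto simp: g_def)
    have "\<exists>u\<in>S. \<exists>v\<in>S. (u, v) \<in> parcs G \<and> g u = g v"
      by (rule R(3)) (use g k S in auto)
    then obtain u v where "u \<in> S" "v \<in> S" "(u, v) \<in> parcs G" "g u = g v" by blast
    then show False using g k irr xy yx unfolding S by auto
  qed
qed

lemma induced_wheel_three_degree_5:
  assumes min: "minimal_non_4_choosable_planar G"
    and dist: "distinct [h, a, b, c, d]" and S: "S = {h, a, b, c, d}"
    and edges: "{(h, a), (h, b), (h, c), (h, d), (a, b), (b, c), (c, d), (d, a)} \<subseteq> parcs G"
    and chords: "(a, c) \<notin> parcs G" "(b, d) \<notin> parcs G"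
    and deg: "\<And>v. v \<in> S \<Longrightarrow> out_degree (with_proj G) v \<le> 5"
  shows "3 \<le> card {v \<in> S. out_degree (with_proj G) v = 5}"
proof (rule ccontr)
  let ?deg = "out_degree (with_proj G)"
  assume "\<not> 3 \<le> card {v \<in> S. ?deg v = 5}"
  then have sum2: "(?deg h - 4) + (?deg a - 4) + (?deg b - 4) + (?deg c - 4) + (?deg d - 4) \<le> 2"
    using sum_excess[where deg = ?deg, OF _ deg dist S] by simp
  have G: "pair_graph G" using min by (auto simp: minimal_non_4_choosable_planar_def)
  have sy: "(v, u) \<in> parcs G" if "(u, v) \<in> parcs G" for u v
    using that G by (auto simp: pair_graph_iff dest: symD)
  have irr: "(v, v) \<notin> parcs G" for v using G by (auto simp: pair_graph_iff irrefl_def)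
  have V: "S \<subseteq> pverts G" "S \<noteq> {}" using edges G S by (auto simp: pair_graph_iff)
  have chords': "(c, a) \<notin> parcs G" "(d, b) \<notin> parcs G" using sy chords by blast+
  have nbs: "parcs G `` {h} \<inter> S = {a, b, c, d}" "parcs G `` {a} \<inter> S = {h, b, d}"
    "parcs G `` {b} \<inter> S = {h, a, c}" "parcs G `` {c} \<inter> S = {h, b, d}" "parcs G `` {d} \<inter> S = {h, a, c}"
    using edges edges[THEN subsetD, THEN sy] irr chords chords' S by auto
  have inS: "h \<in> S" "a \<in> S" "b \<in> S" "c \<in> S" "d \<in> S" using S by auto
  note deg' = deg[OF inS(1)] deg[OF inS(2)] deg[OF inS(3)] deg[OF inS(4)] deg[OF inS(5)]
  obtain R :: "'a \<Rightarrow> nat set" where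
    R: "\<And>v. v \<in> S \<Longrightarrow> finite (R v)"
    "\<And>v. v \<in> S \<Longrightarrow> 4 + card (parcs G `` {v} \<inter> S) \<le> card (R v) + ?deg v"
    "\<And>g. (\<And>v. v \<in> S \<Longrightarrow> g v \<in> R v) \<Longrightarrow> \<exists>u\<in>S. \<exists>v\<in>S. (u, v) \<in> parcs G \<and> g u = g v"
    using uncolorable_residual_lists[OF min V] by blast
  have "4 \<le> card (R h) + (?deg h - 4)" "3 \<le> card (R a) + (?deg a - 4)"
    "3 \<le> card (R b) + (?deg b - 4)" "3 \<le> card (R c) + (?deg c - 4)" "3 \<le> card (R d) + (?deg d - 4)"
    using R(2)[OF inS(1)] R(2)[OF inS(2)] R(2)[OF inS(3)] R(2)[OF inS(4)] R(2)[OF inS(5)] nbs dist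
    by auto
  then have "wheel_colorable (R h) (R a) (R b) (R c) (R d)"
    using sum2 deg' by (intro wheel_colorable_deficient[OF R(1)[OF inS(1)],
          of "?deg h - 4" "?deg a - 4" "?deg b - 4" "?deg c - 4" "?deg d - 4"]) linarith+
  then obtain kh ka kb kc kd where k: "kh \<in> R h" "ka \<in> R a" "kb \<in> R b" "kc \<in> R c" "kd \<in> R d"
    "kh \<notin> {ka, kb, kc, kd}" "ka \<noteq> kb" "kb \<noteq> kc" "kc \<noteq> kd" "kd \<noteq> ka"
    by (rule wheel_colorableE)
  define g where "g = (\<lambda>_. kd)(h := kh, a := ka, b := kb, c := kc)"
  have g: "g h = kh" "g a = ka" "g b = kb" "g c = kc" "g d = kd" using dist by (auto simp: g_def)
  have "\<exists>u\<in>S. \<exists>v\<in>S. (u, v) \<in> parcs G \<and> g u = g v"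
    by (rule R(3)) (use g k S in auto)
  then obtain u v where "u \<in> S" "v \<in> S" "(u, v) \<in> parcs G" "g u = g v" by blast
  then show False using g k irr chords chords' unfolding S by auto
qed

lemma wheel5_isoE:
  fixes W :: "'a pair_pre_digraph"
  assumes "digraph_iso (with_proj W) (with_proj wheel5)"
  obtains h a b c d where "distinct [h, a, b, c, d]" "pverts W = {h, a, b, c, d}"
    "{(h, a), (h, b), (h, c), (h, d), (a, b), (b, c), (c, d), (d, a)} \<subseteq> parcs W"
proof -
  obtain \<phi> where iso: "pre_digraph.digraph_isomorphism (with_proj W) \<phi>"
    and eq: "with_proj wheel5 = app_iso \<phi> (with_proj W)"
    using assms by (auto simp: digraph_iso_def)
  define F where "F = iso_verts \<phi>"
  have wf: "wf_digraph (with_proj W)" and inj: "inj_on F (pverts W)"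
    using iso by (simp_all add: pre_digraph.digraph_isomorphism_def F_def)
  have V: "F ` pverts W = {0, 1, 2, 3, 4}"
    using arg_cong[OF eq, of verts] by (simp add: wheel5_def Let_def verts_app_iso F_def)
  have ex: "\<exists>u v. (u, v) \<in> parcs W \<and> F u = i \<and> F v = j" if ij: "(i, j) \<in> parcs wheel5" for i j
  proof -
    \<comment> \<open>Both graphs have \<open>fst\<close> and \<open>snd\<close> as tail and head,
      so the isomorphism's maps for tails and heads must be these projections.\<close>
    have eqs: "parcs wheel5 = iso_arcs \<phi> ` parcs W" "iso_tail \<phi> = fst" "iso_head \<phi> = snd"
      using arg_cong[OF eq, of arcs] arg_cong[OF eq, of tail] arg_cong[OF eq, of head]
      by (simp_all add: arcs_app_iso tail_app_iso head_app_iso)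
    then obtain u v where uv: "(u, v) \<in> parcs W" "iso_arcs \<phi> (u, v) = (i, j)" using ij by auto
    have "F u = iso_tail \<phi> (iso_arcs \<phi> (u, v))" "F v = iso_head \<phi> (iso_arcs \<phi> (u, v))"
      using iso uv(1) by (auto simp: pre_digraph.digraph_isomorphism_def F_def)
    then show ?thesis using uv eqs by auto
  qed
  define r where "r = inv_into (pverts W) F"
  have r: "F (r i) = i" "r i \<in> pverts W" if "i \<in> {0, 1, 2, 3, 4}" for i
    using that V by (auto simp: r_def f_inv_into_f inv_into_into)
  have Fr: "r (F v) = v" if "v \<in> pverts W" for v using that inj by (simp add: r_def)
  have edge: "(r i, r j) \<in> parcs W" if ij: "(i, j) \<in> parcs wheel5" for i j
  proof -
    obtain u v where uv: "(u, v) \<in> parcs W" "F u = i" "F v = j" using ex[OF ij] by blast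
    then have "u \<in> pverts W" "v \<in> pverts W"
      using wf wf_digraph.tail_in_verts[OF wf, of "(u, v)"] wf_digraph.head_in_verts[OF wf, of "(u, v)"] by auto
    then show ?thesis using uv Fr by auto
  qed
  show thesis
  proof (rule that)
    show "distinct [r 0, r 1, r 2, r 3, r 4]"
      using r(1)[of 0] r(1)[of 1] r(1)[of 2] r(1)[of 3] r(1)[of 4] by auto
    have "pverts W = r ` F ` pverts W" using Fr by force
    then show "pverts W = {r 0, r 1, r 2, r 3, r 4}" unfolding V by simp
    show "{(r 0, r 1), (r 0, r 2), (r 0, r 3), (r 0, r 4), (r 1, r 2), (r 2, r 3), (r 3, r 4), (r 4, r 1)}
      \<subseteq> parcs W"
      using edge by (simp add: wheel5_def Let_def)
  qed
qed

theorem theorem4: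
  fixes G W :: "'a pair_pre_digraph"
    and p :: "'a \<Rightarrow> complex" and c :: "'a \<times> 'a \<Rightarrow> real \<Rightarrow> complex"
  assumes "minimal_non_4_choosable_planar G"
    and "plane_embedding G p c"
    and "subgraph (with_proj W) (with_proj G)"
    and "digraph_iso (with_proj W) (with_proj wheel5)"
    and "\<forall>v\<in>pverts W. out_degree (with_proj G) v \<le> 5"
  shows "card {v \<in> pverts W. out_degree (with_proj G) v = 5} \<ge> 3"
proof -
  obtain h r1 r2 r3 r4 where dist: "distinct [h, r1, r2, r3, r4]" and W: "pverts W = {h, r1, r2, r3, r4}"
    and edgesW: "{(h, r1), (h, r2), (h, r3), (h, r4), (r1, r2), (r2, r3), (r3, r4), (r4, r1)} \<subseteq> parcs W"
    using assms(4) by (rule wheel5_isoE)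
  have edges: "{(h, r1), (h, r2), (h, r3), (h, r4), (r1, r2), (r2, r3), (r3, r4), (r4, r1)} \<subseteq> parcs G"
    using assms(3) edgesW by (auto simp: subgraph_def)
  have G: "pair_graph G" using assms(1) by (auto simp: minimal_non_4_choosable_planar_def)
  have sy: "(v, u) \<in> parcs G" if "(u, v) \<in> parcs G" for u v
    using that G by (auto simp: pair_graph_iff dest: symD)
  have deg: "out_degree (with_proj G) v \<le> 5" if "v \<in> pverts W" for v using assms(5) that by blast
  note edges' = edges edges[THEN subsetD, THEN sy]
  \<comment> \<open>\<open>W\<close> need not be induced, so \<open>G\<close> may contain chords of
    the rim. With one chord, the hub and the ends of the chord form the triangle.\<close>
  consider "(r1, r3) \<in> parcs G" "(r2, r4) \<in> parcs G" | "(r1, r3) \<in> parcs G" "(r2, r4) \<notin> parcs G"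
    | "(r1, r3) \<notin> parcs G" "(r2, r4) \<in> parcs G" | "(r1, r3) \<notin> parcs G" "(r2, r4) \<notin> parcs G" by blast
  then show ?thesis
  proof cases
    case 1
    let ?U = "pverts G - {h, r1, r3}"
    have U: "r2 \<in> ?U" "r4 \<in> ?U" using edges dist G by (auto simp: pair_graph_iff)
    \<comment> \<open>With both chords, the triangle \<open>h r1 r3\<close> would separate the
      adjacent vertices \<open>r2\<close> and \<open>r4\<close>.\<close>
    have "(r2, r4) \<notin> (parcs G \<inter> ?U \<times> ?U)\<^sup>*"
      by (rule separating_triangle[OF assms(2) G, of h r1 r3]) (use dist edges' 1 U in auto)
    then show ?thesis using 1 U by auto
  next
    case 2
    show ?thesis
      by (rule K5_minus_edge_three_degree_5[OF assms(1,2), of h r1 r3 r2 r4])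
        (use dist W edges' 2 deg in auto)
  next
    case 3
    show ?thesis
      by (rule K5_minus_edge_three_degree_5[OF assms(1,2), of h r2 r4 r1 r3])
        (use dist W edges' 3 deg in auto)
  next
    case 4
    show ?thesis
      by (rule induced_wheel_three_degree_5[OF assms(1) dist W edges 4 deg])
  qed
qed

end
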